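(* Let $G$ be a group with lower central series $\gamma_1(G)=G$, $\gamma_{i+1}(G)=[G,\gamma_i(G)]$, and let $A\to\operatorname{Aut}(G)$ be a group homomorphism. For each integer $i>0$ define $$A_i=\{a\in A:\ \forall j>0,\ \forall g\in\gamma_j(G),\ g^{-1}g^a\in\gamma_{i+j}(G)\}.$$ Then for all $i,j>0$, $[A_i,A_j]\leq A_{i+j}$, and $L_*(A)=\bigoplus_{i>0}A_i/A_{i+1}$ is a graded Lie ring, with Lie product induced by commutation in $A$. There is a canonical graded Lie ring homomorphism $L_*(A)\to\operatorname{Der}(L_*(\gamma))$ into the graded derivation ring of $L_*(\gamma)=\bigoplus_{i>0}\gamma_i(G)/\gamma_{i+1}(G)$, sending the class of $a\in A_i$ to the derivation $D_a$ determined by $\bar g D_a=\overline{g^{-1}g^a}\in\gamma_{i+j}(G)/\gamma_{i+j+1}(G)$ for $g\in\gamma_j(G)$. Also, $A/A_1$ is the faithful representation of $A$ acting on $L_*(\gamma)$ by conjugation; that is, $A_1$ is the kernel of the action of $A$ on $L_*(\gamma)$ given by $\bar g\mapsto\overline{g^a}$.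
   Context: Commutators in a group are $[g,h]=g^{-1}h^{-1}gh$, and $[X,Y]=\langle [x,y]:x\in X,y\in Y\rangle$. The group $A$ acts on $G$ on the right through $A\to\operatorname{Aut}(G)$, written $g\mapsto g^a$. Bars denote classes in the relevant quotient groups. $L_*(\gamma)$ is the graded Lie ring with addition induced by group multiplication and Lie product the biadditive extension of $\bar x\circ\bar y=\overline{[x,y]}\in\gamma_{i+j}/\gamma_{i+j+1}$ for $x\in\gamma_i$, $y\in\gamma_j$; the Lie product on $L_*(A)$ is likewise $\bar a\circ\bar b=\overline{[a,b]}\in A_{i+j}/A_{i+j+1}$ for $a\in A_i$, $b\in A_j$. A derivation of $L=L_*(\gamma)$ is an additive map $D$, written on the right, with $(u\circ v)D=(uD)\circ v+u\circ(vD)$; $\operatorname{Der}(L)$ is a Lie ring under $[D,E]=DE-ED$ (first factor applied first). A derivation is homogeneous of degree $i$ if it maps $\gamma_j/\gamma_{j+1}$ into $\gamma_{i+j}/\gamma_{i+j+1}$ for all $j>0$; a graded homomorphism sends $A_i/A_{i+1}$ to derivations of degree $i$. *)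

theory Defs
  imports "HOL-Algebra.Algebra"
begin

section \<open>Commutators and the lower central series\<close>

text \<open>The commutator convention differs from that of \<^const>\<open>derived\<close>, which uses
  \<open>x y x\<inverse> y\<inverse>\<close>.\<close>

definition commutator :: "('a, 'm) monoid_scheme \<Rightarrow> 'a \<Rightarrow> 'a \<Rightarrow> 'a" where
  "commutator G x y = inv\<^bsub>G\<^esub> x \<otimes>\<^bsub>G\<^esub> inv\<^bsub>G\<^esub> y \<otimes>\<^bsub>G\<^esub> x \<otimes>\<^bsub>G\<^esub> y"

definition commutator_subgroup ::
    "('a, 'm) monoid_scheme \<Rightarrow> 'a set \<Rightarrow> 'a set \<Rightarrow> 'a set" where
  "commutator_subgroup G U V = generate G {commutator G x y | x y. x \<in> U \<and> y \<in> V}"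

text \<open>Series are indexed by the positive integers; the value at \<open>0\<close> is never used.\<close>

fun lower_central :: "('a, 'm) monoid_scheme \<Rightarrow> nat \<Rightarrow> 'a set" where
  "lower_central G 0 = carrier G"
| "lower_central G (Suc 0) = carrier G"
| "lower_central G (Suc (Suc i)) =
     commutator_subgroup G (carrier G) (lower_central G (Suc i))"

section \<open>Right actions\<close>

text \<open>In \<^const>\<open>AutoGroup\<close> and \<^const>\<open>BijGroup\<close> the product of \<open>f\<close> and \<open>g\<close> applies \<open>g\<close> first.
  A right action is therefore a homomorphism into the opposite group, so that
  \<open>g\<^sup>a\<close> is \<open>\<phi> a g\<close> and \<open>\<phi> (a b) g = \<phi> b (\<phi> a g)\<close>.\<close>

definition opposite_group :: "'a monoid \<Rightarrow> 'a monoid" where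
  "opposite_group H = \<lparr>carrier = carrier H, monoid.mult = (\<lambda>x y. y \<otimes>\<^bsub>H\<^esub> x), one = \<one>\<^bsub>H\<^esub>\<rparr>"

definition action_series ::
    "('b, 'n) monoid_scheme \<Rightarrow> ('a, 'm) monoid_scheme \<Rightarrow> ('b \<Rightarrow> 'a \<Rightarrow> 'a) \<Rightarrow> nat \<Rightarrow> 'b set" where
  "action_series A G \<phi> i =
     {a \<in> carrier A. \<forall>j>0. \<forall>g\<in>lower_central G j.
        inv\<^bsub>G\<^esub> g \<otimes>\<^bsub>G\<^esub> \<phi> a g \<in> lower_central G (i + j)}"

section \<open>Lie rings\<close>

text \<open>A Lie ring is a ring record whose multiplication is the Lie product; the field
  \<^const>\<open>one\<close> has no meaning.\<close>

locale lie_ring = abelian_group L for L (structure) +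
  assumes lie_closed: "\<lbrakk>x \<in> carrier L; y \<in> carrier L\<rbrakk> \<Longrightarrow> x \<otimes> y \<in> carrier L"
    and lie_add_left: "\<lbrakk>x \<in> carrier L; y \<in> carrier L; z \<in> carrier L\<rbrakk>
          \<Longrightarrow> (x \<oplus> y) \<otimes> z = (x \<otimes> z) \<oplus> (y \<otimes> z)"
    and lie_add_right: "\<lbrakk>x \<in> carrier L; y \<in> carrier L; z \<in> carrier L\<rbrakk>
          \<Longrightarrow> x \<otimes> (y \<oplus> z) = (x \<otimes> y) \<oplus> (x \<otimes> z)"
    and lie_self: "x \<in> carrier L \<Longrightarrow> x \<otimes> x = \<zero>"
    and jacobi: "\<lbrakk>x \<in> carrier L; y \<in> carrier L; z \<in> carrier L\<rbrakk>
          \<Longrightarrow> ((x \<otimes> y) \<otimes> z) \<oplus> ((y \<otimes> z) \<otimes> x) \<oplus> ((z \<otimes> x) \<otimes> y) = \<zero>"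

text \<open>\<open>C i\<close> is the homogeneous component of degree \<open>i > 0\<close>; the last assumption says that
  \<open>L\<close> is the internal direct sum of these components.\<close>

locale graded_lie_ring = lie_ring L
  for L :: "('a, 'm) ring_scheme" (structure) and C :: "nat \<Rightarrow> 'a set" +
  assumes component_subgroup: "i > 0 \<Longrightarrow> subgroup (C i) (add_monoid L)"
    and component_mult: "\<lbrakk>i > 0; j > 0; x \<in> C i; y \<in> C j\<rbrakk> \<Longrightarrow> x \<otimes> y \<in> C (i + j)"
    and component_decomp: "x \<in> carrier L \<Longrightarrow>
          \<exists>!f. f \<in> (\<Pi>\<^sub>E i\<in>{0<..}. C i) \<and> finite {i \<in> {0<..}. f i \<noteq> \<zero>} \<and>
               x = (\<Oplus>i\<in>{i \<in> {0<..}. f i \<noteq> \<zero>}. f i)"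

locale lie_ring_hom = L: lie_ring L + M: lie_ring M
  for L (structure) and M (structure) and h +
  assumes hom_add: "h \<in> hom (add_monoid L) (add_monoid M)"
    and hom_lie: "\<lbrakk>x \<in> carrier L; y \<in> carrier L\<rbrakk> \<Longrightarrow> h (x \<otimes>\<^bsub>L\<^esub> y) = h x \<otimes>\<^bsub>M\<^esub> h y"

definition lie_auto_group :: "('a, 'm) ring_scheme \<Rightarrow> ('a \<Rightarrow> 'a) monoid" where
  "lie_auto_group L = BijGroup (carrier L)
     \<lparr>carrier := {f \<in> Bij (carrier L). lie_ring_hom L L f}\<rparr>"

section \<open>Derivations\<close>

definition derivations :: "('a, 'm) ring_scheme \<Rightarrow> ('a \<Rightarrow> 'a) set" where
  "derivations L =
     {D \<in> carrier L \<rightarrow>\<^sub>E carrier L.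
        D \<in> hom (add_monoid L) (add_monoid L) \<and>
        (\<forall>u\<in>carrier L. \<forall>v\<in>carrier L. D (u \<otimes>\<^bsub>L\<^esub> v) = (D u \<otimes>\<^bsub>L\<^esub> v) \<oplus>\<^bsub>L\<^esub> (u \<otimes>\<^bsub>L\<^esub> D v))}"

text \<open>Derivations are written on the right, so the product \<open>D E\<close> maps \<open>u\<close> to \<open>E (D u)\<close> and
  the Lie product is \<open>D E - E D\<close>.\<close>

definition der_lie_ring :: "('a, 'm) ring_scheme \<Rightarrow> ('a \<Rightarrow> 'a) ring" where
  "der_lie_ring L =
     \<lparr>carrier = derivations L,
      monoid.mult = (\<lambda>D E. \<lambda>u\<in>carrier L. E (D u) \<ominus>\<^bsub>L\<^esub> D (E u)),
      one = undefined,
      ring.zero = (\<lambda>u\<in>carrier L. \<zero>\<^bsub>L\<^esub>),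
      ring.add = (\<lambda>D E. \<lambda>u\<in>carrier L. D u \<oplus>\<^bsub>L\<^esub> E u)\<rparr>"

definition homogeneous_of_degree :: "(nat \<Rightarrow> 'a set) \<Rightarrow> nat \<Rightarrow> ('a \<Rightarrow> 'a) \<Rightarrow> bool" where
  "homogeneous_of_degree C i D \<longleftrightarrow> (\<forall>j>0. \<forall>u\<in>C j. D u \<in> C (i + j))"

section \<open>The Lie ring of a series of subgroups\<close>

definition series_factor :: "('a, 'm) monoid_scheme \<Rightarrow> (nat \<Rightarrow> 'a set) \<Rightarrow> nat \<Rightarrow> 'a set monoid" where
  "series_factor H S i = (H\<lparr>carrier := S i\<rparr>) Mod (S (Suc i))"

text \<open>The product of the cosets \<open>U\<close> and \<open>V\<close> is the union of the classes of all commutators of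
  representatives. When the product of classes is well defined, all these classes coincide and
  the union is that class.\<close>

definition series_bracket ::
    "('a, 'm) monoid_scheme \<Rightarrow> (nat \<Rightarrow> 'a set) \<Rightarrow> nat \<Rightarrow> nat \<Rightarrow> 'a set \<Rightarrow> 'a set \<Rightarrow> 'a set" where
  "series_bracket H S i j U V = (\<Union>x\<in>U. \<Union>y\<in>V. S (Suc (i + j)) #>\<^bsub>H\<^esub> commutator H x y)"

text \<open>The component of degree \<open>k\<close> of a product collects the brackets of the components of
  degrees \<open>i\<close> and \<open>k - i\<close>; \<^const>\<open>finprod\<close> is the sum in the abelian group
  \<^term>\<open>series_factor H S k\<close>.\<close>

definition series_lie_ring ::
    "('a, 'm) monoid_scheme \<Rightarrow> (nat \<Rightarrow> 'a set) \<Rightarrow> (nat \<Rightarrow> 'a set) ring" where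
  "series_lie_ring H S =
     \<lparr>carrier = carrier (sum_group {0<..} (series_factor H S)),
      monoid.mult = (\<lambda>u v. \<lambda>k\<in>{0<..}.
        finprod (series_factor H S k) (\<lambda>i. series_bracket H S i (k - i) (u i) (v (k - i))) {0<..<k}),
      one = undefined,
      ring.zero = \<one>\<^bsub>sum_group {0<..} (series_factor H S)\<^esub>,
      ring.add = monoid.mult (sum_group {0<..} (series_factor H S))\<rparr>"

definition series_component ::
    "('a, 'm) monoid_scheme \<Rightarrow> (nat \<Rightarrow> 'a set) \<Rightarrow> nat \<Rightarrow> (nat \<Rightarrow> 'a set) set" where
  "series_component H S i =
     {u \<in> carrier (series_lie_ring H S). \<forall>j>0. j \<noteq> i \<longrightarrow> u j = \<one>\<^bsub>series_factor H S j\<^esub>}"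

text \<open>The class of \<open>x \<in> S i\<close> in degree \<open>i\<close>, as an element of the direct sum.\<close>

definition series_class ::
    "('a, 'm) monoid_scheme \<Rightarrow> (nat \<Rightarrow> 'a set) \<Rightarrow> nat \<Rightarrow> 'a \<Rightarrow> nat \<Rightarrow> 'a set" where
  "series_class H S i x =
     (\<lambda>k\<in>{0<..}. if k = i then S (Suc i) #>\<^bsub>H\<^esub> x else \<one>\<^bsub>series_factor H S k\<^esub>)"

text \<open>The action on \<open>\<Oplus> S\<^sub>k / S\<^sub>k\<^sub>+\<^sub>1\<close> induced by an action on \<open>G\<close>: each coset
  is replaced by its image.\<close>

definition induced_action ::
    "('a, 'm) monoid_scheme \<Rightarrow> (nat \<Rightarrow> 'a set) \<Rightarrow> ('b \<Rightarrow> 'a \<Rightarrow> 'a)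
      \<Rightarrow> 'b \<Rightarrow> (nat \<Rightarrow> 'a set) \<Rightarrow> nat \<Rightarrow> 'a set" where
  "induced_action G S \<phi> a =
     (\<lambda>u\<in>carrier (series_lie_ring G S). \<lambda>k\<in>{0<..}. \<phi> a ` u k)"

end

theory Submission
  imports Defs
begin

text \<open>Two series of subgroups occur: the lower central series of \<open>G\<close> and the series
  \<open>A\<^sub>i\<close>. Both are strongly central: \<open>[S\<^sub>i, S\<^sub>j] \<le> S\<^sub>i\<^sub>+\<^sub>j\<close>. For the lower
  central series this is the three subgroups lemma (\<open>lower_central_commutator\<close>). For \<open>A\<^sub>i\<close> write
  \<open>d\<^sub>a(g) = g\<^sup>-\<^sup>1 g\<^sup>a\<close>, the commutator \<open>[g, a]\<close> of the semidirect product. Expanding both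
  \<open>g\<^sup>a\<^sup>b\<close> and \<open>g\<^sup>b\<^sup>a\<close> expresses \<open>d\<^bsub>[a,b]\<^esub>\<close> through \<open>d\<^sub>b d\<^sub>a\<close>, \<open>d\<^sub>a d\<^sub>b\<close> and a commutator of
  displacements (\<open>displacement_commutator\<close>), and each of these lies deep enough.

  A strongly central series always yields a graded Lie ring (\<open>graded_lie_ring_L\<close>). Modulo the
  next term, commutation is biadditive and conjugation is trivial, so commutation passes to the
  factors, and the Hall--Witt identity turns into the Jacobi identity. The classes of group elements
  generate the direct sum additively (\<open>L_induct\<close>), so each multilinear law needs to be checked on
  classes only, where it is a statement about group elements.

  Maps out of the direct sum come from its universal property (\<open>additive_extension\<close>). For
  \<open>a \<in> A\<^sub>i\<close> the map \<open>g \<mapsto> d\<^sub>a(g)\<close> is additive modulo the next term, which gives \<open>D\<^sub>a\<close>; expanding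
  \<open>[x d\<^sub>a(x), y d\<^sub>a(y)]\<close> gives the Leibniz rule (\<open>displacement_commutator_class\<close>). Next,
  \<open>a \<mapsto> D\<^sub>a\<close> is additive and vanishes on \<open>A\<^sub>i\<^sub>+\<^sub>1\<close>, so the universal property applies a second time
  and gives the map to the derivations. It respects the Lie product because, on classes, the
  formula for \<open>d\<^bsub>[a,b]\<^esub>\<close> reads \<open>D\<^bsub>[a,b]\<^esub> = D\<^sub>a D\<^sub>b - D\<^sub>b D\<^sub>a\<close> (\<open>action_derivation_commutator\<close>).
  Uniqueness is again generation by classes.

  Finally, \<open>a\<close> fixes the class of \<open>g \<in> \<gamma>\<^sub>j\<close> exactly if \<open>d\<^sub>a(g) \<in> \<gamma>\<^sub>j\<^sub>+\<^sub>1\<close>. Hence the kernel of the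
  induced action is \<open>A\<^sub>1\<close> (\<open>induced_eq_id_iff\<close>).\<close>

section \<open>Commutator identities\<close>

context group
begin

lemma inv_mult_cancel:
  assumes "x \<in> carrier G" "y \<in> carrier G"
  shows "inv x \<otimes> (x \<otimes> y) = y" and "x \<otimes> (inv x \<otimes> y) = y"
  using assms by (simp_all flip: m_assoc)

text \<open>With these rules the simplifier reduces words to normal form in the free group. Once
  commutators are unfolded, it proves every identity that holds for all group elements.\<close>

lemmas word_simps = inv_mult_cancel inv_mult_group m_assoc

lemma commutator_closed [simp, intro]:
  "\<lbrakk>x \<in> carrier G; y \<in> carrier G\<rbrakk> \<Longrightarrow> commutator G x y \<in> carrier G"
  by (simp add: commutator_def)

lemma commutator_self: "x \<in> carrier G \<Longrightarrow> commutator G x x = \<one>"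
  by (simp add: commutator_def word_simps)

lemma inv_commutator:
  "\<lbrakk>x \<in> carrier G; y \<in> carrier G\<rbrakk> \<Longrightarrow> inv (commutator G x y) = commutator G y x"
  by (simp add: commutator_def word_simps)

lemma conjugate_eq_mult_commutator:
  "\<lbrakk>x \<in> carrier G; y \<in> carrier G\<rbrakk> \<Longrightarrow> inv y \<otimes> x \<otimes> y = x \<otimes> commutator G x y"
  by (simp add: commutator_def word_simps)

lemma mult_commute_commutator:
  "\<lbrakk>x \<in> carrier G; y \<in> carrier G\<rbrakk> \<Longrightarrow> x \<otimes> y = y \<otimes> x \<otimes> commutator G x y"
  by (simp add: commutator_def word_simps)

text \<open>In a strongly central series the middle factor lies deeper than the other two. This
  is why commutation becomes additive on the factors.\<close>

lemma commutator_mult_left: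
  assumes "x \<in> carrier G" "y \<in> carrier G" "z \<in> carrier G"
  shows "commutator G (x \<otimes> y) z
    = commutator G x z \<otimes> commutator G (commutator G x z) y \<otimes> commutator G y z"
  using assms by (simp add: commutator_def word_simps)

lemma commutator_mult_right:
  assumes "x \<in> carrier G" "y \<in> carrier G" "z \<in> carrier G"
  shows "commutator G x (y \<otimes> z)
    = commutator G x z \<otimes> (commutator G x y \<otimes> commutator G (commutator G x y) z)"
  using assms by (simp add: commutator_def word_simps)

text \<open>The group-theoretic form of the Jacobi identity. It serves both for the three subgroups
  lemma and for the Jacobi identity itself.\<close>

lemma hall_witt:
  assumes "x \<in> carrier G" "y \<in> carrier G" "z \<in> carrier G"
  shows "(inv y \<otimes> commutator G (commutator G x (inv y)) z \<otimes> y)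
    \<otimes> (inv z \<otimes> commutator G (commutator G y (inv z)) x \<otimes> z)
    \<otimes> (inv x \<otimes> commutator G (commutator G z (inv x)) y \<otimes> x) = \<one>"
  using assms by (simp add: commutator_def word_simps)

end

context normal
begin

lemma conj_iff:
  assumes "h \<in> carrier G" "x \<in> carrier G" shows "inv x \<otimes> h \<otimes> x \<in> H \<longleftrightarrow> h \<in> H"
proof
  assume "inv x \<otimes> h \<otimes> x \<in> H"
  then have "x \<otimes> (inv x \<otimes> h \<otimes> x) \<otimes> inv x \<in> H"
    using assms inv_op_closed2 by blast
  then show "h \<in> H"
    using assms by (simp add: word_simps)
qed (use assms inv_op_closed1 in blast)

lemma commutator_left_mem:
  "\<lbrakk>h \<in> H; x \<in> carrier G\<rbrakk> \<Longrightarrow> commutator G h x \<in> H"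
  using inv_op_closed1[of x h] by (simp add: commutator_def m_assoc)

lemma commutator_sym_mem:
  "\<lbrakk>x \<in> carrier G; y \<in> carrier G\<rbrakk> \<Longrightarrow> commutator G x y \<in> H \<longleftrightarrow> commutator G y x \<in> H"
  by (metis commutator_closed inv_commutator m_inv_closed)

lemma rcos_absorb_left: "\<lbrakk>h \<in> H; x \<in> carrier G\<rbrakk> \<Longrightarrow> H #> (h \<otimes> x) = H #> x"
  by (metis coset_join2 coset_mult_assoc mem_carrier subgroup_axioms subset)

lemma rcos_absorb_right: "\<lbrakk>h \<in> H; x \<in> carrier G\<rbrakk> \<Longrightarrow> H #> (x \<otimes> h) = H #> x"
  by (metis coset_join2 mem_carrier rcos_sum subgroup_axioms r_one one_closed subset coset_mult_one)

lemma rcos_eq_iff: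
  assumes "x \<in> carrier G" "y \<in> carrier G"
  shows "H #> x = H #> y \<longleftrightarrow> inv x \<otimes> y \<in> H"
proof
  assume "H #> x = H #> y"
  then have "H #> (inv x \<otimes> y) = H #> (inv x \<otimes> x)"
    using assms by (metis inv_closed rcos_sum)
  then show "inv x \<otimes> y \<in> H"
    using assms by (metis coset_join1 coset_mult_one inv_closed l_inv m_closed subgroup_axioms subset)
next
  assume "inv x \<otimes> y \<in> H"
  then have "H #> (x \<otimes> (inv x \<otimes> y)) = H #> x"
    using assms by (intro rcos_absorb_right)
  then show "H #> x = H #> y"
    using assms by (simp add: word_simps)
qed

text \<open>The elements whose commutators with a fixed set fall into a normal subgroup form a subgroup,
  which reduces inclusions of commutator subgroups to generators.\<close>

lemma subgroup_commutator_mem: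
  assumes "B \<subseteq> carrier G"
  shows "subgroup {w \<in> carrier G. \<forall>v\<in>B. commutator G w v \<in> H} G"
proof (rule subgroupI)
  show "{w \<in> carrier G. \<forall>v\<in>B. commutator G w v \<in> H} \<noteq> {}"
    using assms by (auto intro!: exI[of _ \<one>] simp: commutator_def subset_iff)
next
  fix w assume w: "w \<in> {w \<in> carrier G. \<forall>v\<in>B. commutator G w v \<in> H}"
  have "commutator G (inv w) v \<in> H" if v: "v \<in> B" for v
  proof -
    have c: "w \<in> carrier G" "v \<in> carrier G" "commutator G v w \<in> H"
      using w v assms commutator_sym_mem by blast+
    then have "inv (inv w) \<otimes> commutator G v w \<otimes> inv w \<in> H"
      by (intro inv_op_closed1) auto
    then show ?thesis
      using c by (simp add: commutator_def word_simps)
  qed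
  then show "inv w \<in> {w \<in> carrier G. \<forall>v\<in>B. commutator G w v \<in> H}"
    using w by simp
next
  fix w w' assume w: "w \<in> {w \<in> carrier G. \<forall>v\<in>B. commutator G w v \<in> H}"
    "w' \<in> {w \<in> carrier G. \<forall>v\<in>B. commutator G w v \<in> H}"
  then have "commutator G w v \<otimes> commutator G (commutator G w v) w' \<otimes> commutator G w' v \<in> H"
    if "v \<in> B" for v
    using that commutator_left_mem[of "commutator G w v" w'] by auto
  then show "w \<otimes> w' \<in> {w \<in> carrier G. \<forall>v\<in>B. commutator G w v \<in> H}"
    using w assms by (auto simp: commutator_mult_left subset_iff)
qed auto

end

section \<open>The lower central series\<close>

context group
begin

lemma hom_commutator:
  assumes "h \<in> hom G G" "x \<in> carrier G" "y \<in> carrier G"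
  shows "h (commutator G x y) = commutator G (h x) (h y)"
proof -
  interpret h: group_hom G G h
    using assms by unfold_locales
  show ?thesis
    using assms by (simp add: commutator_def)
qed

lemma commutator_subgroup_subset:
  "\<lbrakk>subgroup N G; \<And>x y. \<lbrakk>x \<in> U; y \<in> V\<rbrakk> \<Longrightarrow> commutator G x y \<in> N\<rbrakk>
    \<Longrightarrow> commutator_subgroup G U V \<subseteq> N"
  unfolding commutator_subgroup_def by (rule generate_subgroup_incl) auto

lemma lower_central_Suc:
  "0 < i \<Longrightarrow> lower_central G (Suc i) = commutator_subgroup G (carrier G) (lower_central G i)"
  by (cases i) auto

lemma lower_central_mem:
  "\<lbrakk>0 < i; x \<in> carrier G; y \<in> lower_central G i\<rbrakk> \<Longrightarrow> commutator G x y \<in> lower_central G (Suc i)"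
  by (auto simp: lower_central_Suc commutator_subgroup_def intro: generate.incl)

lemma lower_central_normal: "lower_central G i \<lhd> G"
proof (induction i)
  case (Suc i)
  show ?case
  proof (cases "i = 0")
    case False
    interpret N: normal "lower_central G i" G
      by (rule Suc)
    have "generate G {commutator G x y | x y. x \<in> carrier G \<and> y \<in> lower_central G i} \<lhd> G"
    proof (rule normal_generateI)
      fix h g
      assume h: "h \<in> {commutator G x y | x y. x \<in> carrier G \<and> y \<in> lower_central G i}"
        and g: "g \<in> carrier G"
      obtain x y where xy: "h = commutator G x y" "x \<in> carrier G" "y \<in> lower_central G i"
        using h by blast
      have "g \<otimes> h \<otimes> inv g = commutator G (g \<otimes> x \<otimes> inv g) (g \<otimes> y \<otimes> inv g)"
        using xy g by (simp add: commutator_def word_simps)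
      then show "g \<otimes> h \<otimes> inv g \<in> {commutator G x y | x y. x \<in> carrier G \<and> y \<in> lower_central G i}"
        using xy g N.inv_op_closed2 by blast
    qed (use N.subset in auto)
    then show ?thesis
      using False by (simp add: lower_central_Suc commutator_subgroup_def)
  qed (simp add: normal_self)
qed (simp add: normal_self)

lemma lower_central_Suc_subset: "lower_central G (Suc i) \<subseteq> lower_central G i"
proof (cases "i = 0")
  case False
  interpret N: normal "lower_central G i" G
    by (rule lower_central_normal)
  have "commutator G x y \<in> lower_central G i" if "x \<in> carrier G" "y \<in> lower_central G i" for x y
    using that N.commutator_left_mem[of y x] N.commutator_sym_mem[of x y] N.subset by blast
  then have "commutator_subgroup G (carrier G) (lower_central G i) \<subseteq> lower_central G i"
    by (intro commutator_subgroup_subset N.subgroup_axioms)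
  then show ?thesis
    using False by (simp add: lower_central_Suc)
qed simp

lemma lower_central_hom:
  assumes "h \<in> hom G G"
  shows "x \<in> lower_central G i \<Longrightarrow> h x \<in> lower_central G i"
proof (induction i arbitrary: x)
  case 0
  then show ?case
    using assms by (auto simp: hom_def)
next
  case (Suc i)
  interpret h: group_hom G G h
    using assms by unfold_locales
  interpret N: normal "lower_central G i" G
    by (rule lower_central_normal)
  let ?C = "{commutator G x y | x y. x \<in> carrier G \<and> y \<in> lower_central G i}"
  show ?case
  proof (cases "i = 0")
    case False
    have "h ` ?C \<subseteq> ?C"
    proof
      fix z assume "z \<in> h ` ?C"
      then obtain x y where xy: "z = h (commutator G x y)" "x \<in> carrier G" "y \<in> lower_central G i"
        by blast
      then have "z = commutator G (h x) (h y)"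
        using hom_commutator[OF assms] N.subset by blast
      then show "z \<in> ?C"
        using xy Suc.IH h.hom_closed by blast
    qed
    moreover have "h ` generate G ?C = generate G (h ` ?C)"
      using h.generate_img[of ?C] N.subset by auto
    ultimately have "h ` generate G ?C \<subseteq> generate G ?C"
      using mono_generate[of "h ` ?C" ?C] by simp
    then show ?thesis
      using Suc.prems False by (auto simp: lower_central_Suc commutator_subgroup_def)
  qed (use Suc.prems h.hom_closed in auto)
qed

text \<open>By induction on \<open>i\<close>, the Hall--Witt identity being the three subgroups lemma: two of its
  factors lie in \<open>\<gamma>\<^bsub>i+j+1\<^esub>\<close> by the induction hypothesis, hence so does the third.\<close>

lemma lower_central_commutator:
  "\<lbrakk>0 < i; 0 < j; x \<in> lower_central G i; y \<in> lower_central G j\<rbrakk>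
    \<Longrightarrow> commutator G x y \<in> lower_central G (i + j)"
proof (induction i arbitrary: j x y rule: nat_induct_non_zero)
  case 1
  then show ?case
    by (simp add: lower_central_mem)
next
  case (Suc i)
  define N where "N = lower_central G (Suc i + j)"
  interpret N: normal N G
    unfolding N_def by (rule lower_central_normal)
  interpret I: normal "lower_central G i" G
    by (rule lower_central_normal)
  interpret J: normal "lower_central G j" G
    by (rule lower_central_normal)
  interpret J': normal "lower_central G (Suc j)" G
    by (rule lower_central_normal)
  have gen: "commutator G (commutator G g u) v \<in> N"
    if g: "g \<in> carrier G" and u: "u \<in> lower_central G i" and v: "v \<in> lower_central G j" for g u v
  proof -
    define w where "w = inv u"
    have w: "w \<in> lower_central G i" "w \<in> carrier G" "u \<in> carrier G" "v \<in> carrier G" "inv w = u"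
      using u v by (auto simp: w_def)
    (* Two factors of the Hall-Witt identity for g, w, v lie in N; the third is a conjugate of [[g, u], v]. *)
    have "commutator G w (inv v) \<in> lower_central G (i + j)"
      using Suc v w by blast
    then have "commutator G g (commutator G w (inv v)) \<in> N"
      using g Suc.hyps lower_central_mem by (simp add: N_def)
    then have second: "inv v \<otimes> commutator G (commutator G w (inv v)) g \<otimes> v \<in> N"
      using g w by (intro N.inv_op_closed1) (auto simp: N.commutator_sym_mem)
    have "commutator G (inv g) v \<in> lower_central G (Suc j)"
      using g v Suc.prems by (simp add: lower_central_mem)
    then have "commutator G v (inv g) \<in> lower_central G (Suc j)"
      using g w by (simp add: J'.commutator_sym_mem)
    then have "commutator G w (commutator G v (inv g)) \<in> N"
      using Suc.IH[of "Suc j"] w by (simp add: N_def)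
    then have third: "inv g \<otimes> commutator G (commutator G v (inv g)) w \<otimes> g \<in> N"
      using g w by (intro N.inv_op_closed1) (auto simp: N.commutator_sym_mem)
    let ?a = "inv w \<otimes> commutator G (commutator G g (inv w)) v \<otimes> w"
    let ?b = "inv v \<otimes> commutator G (commutator G w (inv v)) g \<otimes> v"
    let ?c = "inv g \<otimes> commutator G (commutator G v (inv g)) w \<otimes> g"
    have "?a \<otimes> ?b \<otimes> ?c = \<one>"
      using g w by (intro hall_witt) auto
    then have "?a = inv (?b \<otimes> ?c)"
      using g w by (intro inv_equality[symmetric]) (auto simp: m_assoc)
    then have "?a \<in> N"
      using second third by simp
    then show ?thesis
      using g w by (subst (asm) N.conj_iff) auto
  qed
  have "commutator_subgroup G (carrier G) (lower_central G i)
      \<subseteq> {w \<in> carrier G. \<forall>v\<in>lower_central G j. commutator G w v \<in> N}"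
    using gen I.subset by (intro commutator_subgroup_subset N.subgroup_commutator_mem J.subset) auto
  then have "lower_central G (Suc i) \<subseteq> {w \<in> carrier G. \<forall>v\<in>lower_central G j. commutator G w v \<in> N}"
    using Suc.hyps by (simp add: lower_central_Suc)
  then show ?case
    using Suc.prems by (auto simp: N_def)
qed

end

section \<open>Strongly central series and their factors\<close>

text \<open>The hypothesis under which commutation induces a Lie product on the factors. Normality in
  all of \<open>H\<close>, and not just in \<open>S 1\<close>, allows cosets to be multiplied as elements of a quotient of
  \<open>H\<close>.\<close>

locale strongly_central_series = group H for H (structure) +
  fixes S :: "nat \<Rightarrow> 'a set"
  assumes series_normal: "0 < i \<Longrightarrow> S i \<lhd> H"
    and series_Suc_subset: "0 < i \<Longrightarrow> S (Suc i) \<subseteq> S i"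
    and series_commutator:
      "\<lbrakk>0 < i; 0 < j; x \<in> S i; y \<in> S j\<rbrakk> \<Longrightarrow> commutator H x y \<in> S (i + j)"

context group
begin

lemma strongly_central_series_lower_central: "strongly_central_series G (lower_central G)"
  by (intro strongly_central_series.intro strongly_central_series_axioms.intro is_group
      lower_central_normal lower_central_Suc_subset lower_central_commutator)

end

context strongly_central_series
begin

lemma series_subgroup: "0 < i \<Longrightarrow> subgroup (S i) H"
  using series_normal normal_imp_subgroup by blast

lemma series_carrier: "\<lbrakk>x \<in> S i; 0 < i\<rbrakk> \<Longrightarrow> x \<in> carrier H"
  using series_subgroup subgroup.subset by blast

lemma series_mono:
  assumes "0 < i" "i \<le> j" shows "S j \<subseteq> S i"
  using assms(2)
proof (induction rule: dec_induct)
  case (step n)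
  then show ?case
    using assms(1) series_Suc_subset[of n] by simp
qed simp

lemma series_mem_mono: "\<lbrakk>x \<in> S j; i \<le> j; 0 < i\<rbrakk> \<Longrightarrow> x \<in> S i"
  using series_mono by blast

lemma series_commutator_le:
  "\<lbrakk>x \<in> S i; y \<in> S j; 0 < i; 0 < j; 0 < n; n \<le> i + j\<rbrakk> \<Longrightarrow> commutator H x y \<in> S n"
  using series_commutator series_mem_mono by blast

lemma series_mult: "\<lbrakk>0 < i; x \<in> S i; y \<in> S i\<rbrakk> \<Longrightarrow> x \<otimes> y \<in> S i"
  using series_subgroup subgroup.m_closed by metis

lemma series_inv: "\<lbrakk>0 < i; x \<in> S i\<rbrakk> \<Longrightarrow> inv x \<in> S i"
  using series_subgroup subgroup.m_inv_closed by metis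

lemma series_one: "0 < i \<Longrightarrow> \<one> \<in> S i"
  using series_subgroup subgroup.one_closed by metis

lemma series_conj: "\<lbrakk>0 < i; x \<in> S i; y \<in> carrier H\<rbrakk> \<Longrightarrow> inv y \<otimes> x \<otimes> y \<in> S i"
  using series_normal normal.inv_op_closed1 by metis

abbreviation factor :: "nat \<Rightarrow> 'a set monoid" where
  "factor \<equiv> series_factor H S"

lemma carrier_factor: "0 < k \<Longrightarrow> carrier (factor k) = (\<lambda>x. S (Suc k) #> x) ` S k"
  by (simp add: series_factor_def carrier_FactGroup)

lemma one_factor: "\<one>\<^bsub>factor k\<^esub> = S (Suc k)"
  by (simp add: series_factor_def)

lemma mult_factor: "U \<otimes>\<^bsub>factor k\<^esub> V = U <#> V"
  by (simp add: series_factor_def)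

lemma mult_factor_rcos:
  assumes "x \<in> S k" "y \<in> S k" "0 < k"
  shows "(S (Suc k) #> x) \<otimes>\<^bsub>factor k\<^esub> (S (Suc k) #> y) = S (Suc k) #> (x \<otimes> y)"
proof -
  interpret N: normal "S (Suc k)" H
    by (simp add: series_normal)
  show ?thesis
    using assms by (simp add: mult_factor series_carrier N.rcos_sum)
qed

text \<open>A commutator of two elements of \<open>S k\<close> lies in \<open>S (2 k)\<close>, and \<open>2 k > k\<close>.\<close>

lemma factor_commute:
  assumes "x \<in> S k" "y \<in> S k" "0 < k"
  shows "S (Suc k) #> (x \<otimes> y) = S (Suc k) #> (y \<otimes> x)"
proof -
  interpret N: normal "S (Suc k)" H
    by (simp add: series_normal)
  have "commutator H x y \<in> S (Suc k)"
    using assms by (intro series_commutator_le[OF assms(1,2)]) auto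
  then show ?thesis
    using assms mult_commute_commutator[of x y] N.rcos_absorb_right[of _ "y \<otimes> x"]
    by (simp add: series_carrier)
qed

lemma factor_comm_group:
  assumes "0 < k" shows "comm_group (factor k)"
proof -
  have "S (Suc k) \<lhd> H\<lparr>carrier := S k\<rparr>"
    using assms series_normal series_subgroup series_Suc_subset by (intro normal_restrict_supergroup) auto
  then have "group (factor k)"
    unfolding series_factor_def by (rule normal.factorgroup_is_group)
  then show ?thesis
    by (rule group.group_comm_groupI)
      (use assms in \<open>auto simp: carrier_factor mult_factor_rcos factor_commute\<close>)
qed

lemma factor_group: "0 < k \<Longrightarrow> group (factor k)"
  using factor_comm_group comm_group.axioms by blast

lemma factor_one_closed: "0 < k \<Longrightarrow> \<one>\<^bsub>factor k\<^esub> \<in> carrier (factor k)"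
  using factor_group[THEN group.is_monoid, THEN monoid.one_closed] .

lemma factor_one_mult_one: "0 < k \<Longrightarrow> \<one>\<^bsub>factor k\<^esub> \<otimes>\<^bsub>factor k\<^esub> \<one>\<^bsub>factor k\<^esub> = \<one>\<^bsub>factor k\<^esub>"
  using factor_group[THEN group.is_monoid, THEN monoid.l_one, OF _ factor_one_closed] by blast

lemma rcos_eq_one_iff:
  "\<lbrakk>0 < k; x \<in> S k\<rbrakk> \<Longrightarrow> S (Suc k) #> x = \<one>\<^bsub>factor k\<^esub> \<longleftrightarrow> x \<in> S (Suc k)"
  using series_subgroup[of "Suc k"] coset_join1 coset_join2 series_carrier
  by (metis one_factor zero_less_Suc)

abbreviation bracket :: "nat \<Rightarrow> nat \<Rightarrow> 'a set \<Rightarrow> 'a set \<Rightarrow> 'a set" where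
  "bracket \<equiv> series_bracket H S"

text \<open>A change of representatives by \<open>s\<close> and \<open>t\<close>, each one step deeper, alters the commutator only by
  factors in \<open>S (i + j + 1)\<close>. So all classes in the union that defines the bracket agree.\<close>

lemma bracket_rcos:
  assumes "0 < i" "0 < j" "x \<in> S i" "y \<in> S j"
  shows "bracket i j (S (Suc i) #> x) (S (Suc j) #> y) = S (Suc (i + j)) #> commutator H x y"
proof -
  interpret N: normal "S (Suc (i + j))" H
    by (simp add: series_normal)
  have same: "S (Suc (i + j)) #> commutator H (s \<otimes> x) (t \<otimes> y)
      = S (Suc (i + j)) #> commutator H x y" if s: "s \<in> S (Suc i)" and t: "t \<in> S (Suc j)" for s t
  proof -
    have c: "s \<in> carrier H" "t \<in> carrier H" "x \<in> carrier H" "y \<in> carrier H"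
      using assms s t series_carrier by auto
    have tj: "t \<in> S j" and si: "s \<in> S i"
      using assms s t series_Suc_subset by blast+
    have 1: "commutator H s (t \<otimes> y) \<in> S (Suc (i + j))"
      using assms by (intro series_commutator_le[OF s series_mult[OF _ tj \<open>y \<in> S j\<close>]]) auto
    have 2: "commutator H x t \<in> S (Suc (i + j))"
      using assms by (intro series_commutator_le[OF \<open>x \<in> S i\<close> t]) auto
    have "commutator H (s \<otimes> x) (t \<otimes> y) = (commutator H s (t \<otimes> y)
        \<otimes> commutator H (commutator H s (t \<otimes> y)) x) \<otimes> commutator H x (t \<otimes> y)"
      using c by (simp add: commutator_mult_left)
    moreover have "commutator H x (t \<otimes> y)
        = commutator H x y \<otimes> (commutator H x t \<otimes> commutator H (commutator H x t) y)"
      using c by (rule_tac commutator_mult_right)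
    ultimately show ?thesis
      using 1 2 c N.commutator_left_mem
      by (simp only: N.rcos_absorb_left N.rcos_absorb_right N.m_closed commutator_closed m_closed)
  qed
  have "S (Suc i) #> x = (\<lambda>s. s \<otimes> x) ` S (Suc i)" "S (Suc j) #> y = (\<lambda>t. t \<otimes> y) ` S (Suc j)"
    by (auto simp: r_coset_def)
  then show ?thesis
    using same series_one[of "Suc i"] series_one[of "Suc j"] by (auto simp: series_bracket_def)
qed

lemma bracket_closed:
  "\<lbrakk>0 < i; 0 < j; U \<in> carrier (factor i); V \<in> carrier (factor j)\<rbrakk>
    \<Longrightarrow> bracket i j U V \<in> carrier (factor (i + j))"
  using series_commutator by (auto simp: carrier_factor bracket_rcos)

lemma bracket_mult_left:
  assumes "0 < i" "0 < j"
    and U: "U \<in> carrier (factor i)" and V: "V \<in> carrier (factor i)" and W: "W \<in> carrier (factor j)"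
  shows "bracket i j (U \<otimes>\<^bsub>factor i\<^esub> V) W = bracket i j U W \<otimes>\<^bsub>factor (i + j)\<^esub> bracket i j V W"
proof -
  interpret N: normal "S (Suc (i + j))" H
    by (simp add: series_normal)
  obtain x y z where xyz: "x \<in> S i" "y \<in> S i" "z \<in> S j"
    "U = S (Suc i) #> x" "V = S (Suc i) #> y" "W = S (Suc j) #> z"
    using assms by (auto simp: carrier_factor)
  have c: "x \<in> carrier H" "y \<in> carrier H" "z \<in> carrier H"
    using assms xyz series_carrier by auto
  have xz: "commutator H x z \<in> S (i + j)" "commutator H y z \<in> S (i + j)"
    using assms xyz series_commutator by auto
  have "commutator H (commutator H x z) y \<in> S (Suc (i + j))"
    using assms by (intro series_commutator_le[OF xz(1) xyz(2)]) auto
  then have "S (Suc (i + j)) #> commutator H (x \<otimes> y) z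
      = S (Suc (i + j)) #> (commutator H x z \<otimes> commutator H y z)"
    using c by (simp add: commutator_mult_left N.rcos_absorb_right flip: N.rcos_sum)
  then show ?thesis
    using assms xyz xz by (simp add: mult_factor_rcos bracket_rcos series_mult)
qed

lemma bracket_mult_right:
  assumes "0 < i" "0 < j"
    and U: "U \<in> carrier (factor i)" and V: "V \<in> carrier (factor i)" and W: "W \<in> carrier (factor j)"
  shows "bracket j i W (U \<otimes>\<^bsub>factor i\<^esub> V) = bracket j i W U \<otimes>\<^bsub>factor (j + i)\<^esub> bracket j i W V"
proof -
  interpret N: normal "S (Suc (j + i))" H
    by (simp add: series_normal)
  obtain x y z where xyz: "x \<in> S i" "y \<in> S i" "z \<in> S j"
    "U = S (Suc i) #> x" "V = S (Suc i) #> y" "W = S (Suc j) #> z"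
    using assms by (auto simp: carrier_factor)
  have c: "x \<in> carrier H" "y \<in> carrier H" "z \<in> carrier H"
    using assms xyz series_carrier by auto
  have xz: "commutator H z x \<in> S (j + i)" "commutator H z y \<in> S (j + i)"
    using assms xyz series_commutator by auto
  have "commutator H (commutator H z x) y \<in> S (Suc (j + i))"
    using assms by (intro series_commutator_le[OF xz(1) xyz(2)]) auto
  then have "S (Suc (j + i)) #> commutator H z (x \<otimes> y)
      = S (Suc (j + i)) #> (commutator H z y \<otimes> commutator H z x)"
    using c by (simp add: commutator_mult_right N.rcos_absorb_right flip: N.rcos_sum)
  also have "\<dots> = S (Suc (j + i)) #> (commutator H z x \<otimes> commutator H z y)"
    using xz assms by (intro factor_commute) auto
  finally show ?thesis
    using assms xyz xz by (simp add: mult_factor_rcos bracket_rcos series_mult)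
qed

lemma bracket_one_left:
  assumes "0 < i" "0 < j" "W \<in> carrier (factor j)"
  shows "bracket i j \<one>\<^bsub>factor i\<^esub> W = \<one>\<^bsub>factor (i + j)\<^esub>"
proof -
  obtain z where z: "z \<in> S j" "W = S (Suc j) #> z"
    using assms by (auto simp: carrier_factor)
  have one: "\<one>\<^bsub>factor i\<^esub> = S (Suc i) #> \<one>"
    using rcos_eq_one_iff[of i \<one>] assms by (simp add: series_one)
  have "commutator H \<one> z = \<one>"
    using series_carrier[OF z(1)] assms by (simp add: commutator_def)
  then show ?thesis
    using assms z unfolding one by (simp add: bracket_rcos series_one rcos_eq_one_iff)
qed

lemma bracket_one_right:
  assumes "0 < i" "0 < j" "W \<in> carrier (factor j)"
  shows "bracket j i W \<one>\<^bsub>factor i\<^esub> = \<one>\<^bsub>factor (j + i)\<^esub>"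
proof -
  obtain z where z: "z \<in> S j" "W = S (Suc j) #> z"
    using assms by (auto simp: carrier_factor)
  have one: "\<one>\<^bsub>factor i\<^esub> = S (Suc i) #> \<one>"
    using rcos_eq_one_iff[of i \<one>] assms by (simp add: series_one)
  have "commutator H z \<one> = \<one>"
    using series_carrier[OF z(1)] assms by (simp add: commutator_def)
  then show ?thesis
    using assms z unfolding one by (simp add: bracket_rcos series_one rcos_eq_one_iff)
qed

end

section \<open>The direct sum of the factors\<close>

context strongly_central_series
begin

abbreviation L :: "(nat \<Rightarrow> 'a set) ring" where
  "L \<equiv> series_lie_ring H S"

abbreviation cls :: "nat \<Rightarrow> 'a \<Rightarrow> nat \<Rightarrow> 'a set" where
  "cls \<equiv> series_class H S"

lemma carrier_L:
  "carrier L = {u \<in> \<Pi>\<^sub>E k\<in>{0<..}. carrier (factor k). finite {k \<in> {0<..}. u k \<noteq> \<one>\<^bsub>factor k\<^esub>}}"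
  using carrier_sum_group[of "{0<..}" factor] factor_group by (simp add: series_lie_ring_def)

lemma zero_L: "\<zero>\<^bsub>L\<^esub> = (\<lambda>k\<in>{0<..}. \<one>\<^bsub>factor k\<^esub>)"
  by (simp add: series_lie_ring_def)

lemma add_L: "u \<oplus>\<^bsub>L\<^esub> v = (\<lambda>k\<in>{0<..}. u k \<otimes>\<^bsub>factor k\<^esub> v k)"
  by (simp add: series_lie_ring_def)

lemma mult_L: "u \<otimes>\<^bsub>L\<^esub> v = (\<lambda>k\<in>{0<..}.
    finprod (factor k) (\<lambda>i. bracket i (k - i) (u i) (v (k - i))) {0<..<k})"
  by (simp add: series_lie_ring_def)

lemma L_coord: "\<lbrakk>u \<in> carrier L; 0 < k\<rbrakk> \<Longrightarrow> u k \<in> carrier (factor k)"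
  by (auto simp: carrier_L)

lemma L_eqI:
  assumes "u \<in> carrier L" "v \<in> carrier L" "\<And>k. 0 < k \<Longrightarrow> u k = v k"
  shows "u = v"
  using assms by (auto simp: carrier_L intro: PiE_ext)

lemma L_coord_rep:
  assumes "u \<in> carrier L" "0 < k"
  obtains x where "x \<in> S k" "u k = S (Suc k) #> x"
  using L_coord[OF assms] assms by (auto simp: carrier_factor)

lemma abelian_group_L: "abelian_group L"
proof -
  interpret sum: group "sum_group {0<..} factor"
    using sum_group[of "{0<..}" factor] factor_group by simp
  have L: "carrier L = carrier (sum_group {0<..} factor)" "add L = monoid.mult (sum_group {0<..} factor)"
    "\<zero>\<^bsub>L\<^esub> = \<one>\<^bsub>sum_group {0<..} factor\<^esub>"
    by (simp_all add: series_lie_ring_def)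
  show ?thesis
  proof (rule abelian_groupI)
    fix u v assume "u \<in> carrier L" "v \<in> carrier L"
    then show "u \<oplus>\<^bsub>L\<^esub> v = v \<oplus>\<^bsub>L\<^esub> u"
      using comm_monoid.m_comm[OF comm_group.axioms(1)[OF factor_comm_group]]
      by (auto simp only: add_L L_coord greaterThan_iff intro!: restrict_ext)
  next
    fix u assume "u \<in> carrier L"
    then show "\<exists>v\<in>carrier L. v \<oplus>\<^bsub>L\<^esub> u = \<zero>\<^bsub>L\<^esub>"
      using sum.l_inv sum.inv_closed unfolding L by blast
  qed (use sum.m_assoc in \<open>auto simp only: L sum.m_closed sum.one_closed sum.l_one\<close>)
qed

end

sublocale strongly_central_series \<subseteq> L: abelian_group L
  by (rule abelian_group_L)

context strongly_central_series
begin

lemma cls_apply: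
  "0 < k \<Longrightarrow> cls i x k = (if k = i then S (Suc i) #> x else \<one>\<^bsub>factor k\<^esub>)"
  by (simp add: series_class_def)

lemma cls_closed [intro]:
  assumes "0 < i" "x \<in> S i" shows "cls i x \<in> carrier L"
proof -
  have "{k \<in> {0<..}. cls i x k \<noteq> \<one>\<^bsub>factor k\<^esub>} \<subseteq> {i}"
    by (auto simp: cls_apply)
  then have "finite {k \<in> {0<..}. cls i x k \<noteq> \<one>\<^bsub>factor k\<^esub>}"
    by (rule finite_subset) simp
  moreover have "cls i x \<in> (\<Pi>\<^sub>E k\<in>{0<..}. carrier (factor k))"
    using assms factor_one_closed
    by (auto simp: series_class_def carrier_factor)
  ultimately show ?thesis
    by (simp add: carrier_L)
qed

lemma cls_mult:
  assumes "0 < i" "x \<in> S i" "y \<in> S i"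
  shows "cls i (x \<otimes> y) = cls i x \<oplus>\<^bsub>L\<^esub> cls i y"
  using assms factor_one_mult_one
  by (auto simp: add_L cls_apply mult_factor_rcos series_class_def intro!: restrict_ext)

lemma cls_eq_zero_iff:
  assumes "0 < i" "x \<in> S i"
  shows "cls i x = \<zero>\<^bsub>L\<^esub> \<longleftrightarrow> x \<in> S (Suc i)"
proof -
  have "cls i x = \<zero>\<^bsub>L\<^esub> \<longleftrightarrow> S (Suc i) #> x = \<one>\<^bsub>factor i\<^esub>"
    using assms by (auto simp: zero_L series_class_def fun_eq_iff restrict_def)
  then show ?thesis
    using assms rcos_eq_one_iff by simp
qed

lemma cls_inv:
  assumes "0 < i" "x \<in> S i"
  shows "cls i (inv x) = \<ominus>\<^bsub>L\<^esub> cls i x"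
proof -
  have "cls i (inv x) \<oplus>\<^bsub>L\<^esub> cls i x = cls i \<one>"
    using assms series_inv[OF assms] series_carrier[OF assms(2,1)] by (simp flip: cls_mult)
  also have "\<dots> = \<zero>\<^bsub>L\<^esub>"
    using assms by (simp add: cls_eq_zero_iff series_one)
  finally show ?thesis
    using assms series_inv by (intro L.minus_equality[symmetric]) auto
qed

lemma cls_eq_iff:
  assumes "0 < i" "x \<in> S i" "y \<in> S i"
  shows "cls i x = cls i y \<longleftrightarrow> inv x \<otimes> y \<in> S (Suc i)"
proof -
  have "cls i x = cls i y \<longleftrightarrow> cls i (inv x \<otimes> y) = \<zero>\<^bsub>L\<^esub>"
    using assms series_inv
    by (simp add: cls_mult cls_inv) (metis L.add.inv_closed L.add.inv_equality L.l_neg L.minus_minus cls_closed)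
  then show ?thesis
    using assms by (simp add: cls_eq_zero_iff series_inv series_mult)
qed

text \<open>Since \<open>y\<inverse> x y = x [x, y]\<close> and \<open>[x, y]\<close> lies one step deeper.\<close>

lemma cls_conj:
  assumes "0 < i" "x \<in> S i" "y \<in> S 1"
  shows "cls i (inv y \<otimes> x \<otimes> y) = cls i x"
proof -
  have c: "commutator H x y \<in> S (Suc i)"
    using series_commutator[of i 1 x y] assms by simp
  then have "commutator H x y \<in> S i"
    using assms series_Suc_subset by blast
  then have "cls i (x \<otimes> commutator H x y) = cls i x"
    using assms c by (simp add: cls_mult iffD2[OF cls_eq_zero_iff] cls_closed)
  then show ?thesis
    using assms by (simp add: conjugate_eq_mult_commutator series_carrier)
qed

text \<open>The classes generate \<open>L\<close> additively: peel off the nonzero coordinates one at a time.\<close>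

lemma L_induct [consumes 1, case_names cls add]:
  assumes u: "u \<in> carrier L"
    and cls: "\<And>i x. \<lbrakk>0 < i; x \<in> S i\<rbrakk> \<Longrightarrow> P (cls i x)"
    and add: "\<And>u v. \<lbrakk>u \<in> carrier L; v \<in> carrier L; P u; P v\<rbrakk> \<Longrightarrow> P (u \<oplus>\<^bsub>L\<^esub> v)"
  shows "P u"
proof -
  have "finite {k \<in> {0<..}. u k \<noteq> \<one>\<^bsub>factor k\<^esub>}"
    using u by (simp add: carrier_L)
  then show ?thesis
    using u
  proof (induction "{k \<in> {0<..}. u k \<noteq> \<one>\<^bsub>factor k\<^esub>}" arbitrary: u rule: finite_induct)
    case empty
    then have "u k = \<one>\<^bsub>factor k\<^esub>" if "0 < k" for k
      using that by blast
    then have "u = \<zero>\<^bsub>L\<^esub>"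
      by (intro L_eqI[OF empty.prems L.zero_closed]) (simp add: zero_L)
    also have "\<dots> = cls 1 \<one>"
      using series_one[of 1] series_one[of 2] cls_eq_zero_iff[of 1 \<one>] by (simp add: numeral_2_eq_2)
    finally show ?case
      using cls[of 1 \<one>] series_one by simp
  next
    case (insert k F)
    then have k: "0 < k"
      by blast
    obtain x where x: "x \<in> S k" "u k = S (Suc k) #> x"
      using L_coord_rep[OF insert.prems k] .
    define v where "v = u(k := \<one>\<^bsub>factor k\<^esub>)"
    have F: "F = {j \<in> {0<..}. v j \<noteq> \<one>\<^bsub>factor j\<^esub>}"
      using insert.hyps by (auto simp: v_def)
    have "v \<in> (\<Pi>\<^sub>E k\<in>{0<..}. carrier (factor k))"
      using insert.prems k factor_one_closed
      by (auto simp: v_def carrier_L PiE_iff extensional_def)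
    then have v: "v \<in> carrier L"
      using insert.hyps(1) F by (simp add: carrier_L)
    have "u = cls k x \<oplus>\<^bsub>L\<^esub> v"
    proof (rule L_eqI)
      fix j :: nat assume "0 < j"
      then show "u j = (cls k x \<oplus>\<^bsub>L\<^esub> v) j"
        using x(2) L_coord[OF insert.prems \<open>0 < j\<close>] factor_group[OF \<open>0 < j\<close>, THEN group.is_monoid]
        by (cases "j = k") (simp_all add: add_L cls_apply v_def monoid.l_one monoid.r_one)
    qed (use insert.prems v x k in auto)
    then show ?case
      using insert.hyps(3)[OF F v] cls[OF k x(1)] add[OF cls_closed[OF k x(1)] v] by simp
  qed
qed

lemma series_component_eq:
  assumes "0 < i"
  shows "series_component H S i = cls i ` S i"
proof (intro subset_antisym subsetI)
  fix u assume "u \<in> series_component H S i"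
  then have u: "u \<in> carrier L" "\<And>k. \<lbrakk>0 < k; k \<noteq> i\<rbrakk> \<Longrightarrow> u k = \<one>\<^bsub>factor k\<^esub>"
    by (auto simp: series_component_def)
  obtain x where x: "x \<in> S i" "u i = S (Suc i) #> x"
    using L_coord_rep[OF u(1) assms] .
  have "u = cls i x"
    using u x assms by (intro L_eqI) (auto simp: cls_apply)
  then show "u \<in> cls i ` S i"
    using x by blast
qed (use assms in \<open>auto simp: series_component_def cls_apply\<close>)

text \<open>A sum of homogeneous elements determines its summands, which is the uniqueness part of the
  direct sum decomposition.\<close>

lemma finsum_coord:
  assumes "finite F" "F \<subseteq> {0<..}" "\<And>i. i \<in> F \<Longrightarrow> f i \<in> series_component H S i" "0 < k"
  shows "(\<Oplus>\<^bsub>L\<^esub>i\<in>F. f i) k = (if k \<in> F then f k k else \<one>\<^bsub>factor k\<^esub>)"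
  using assms(1-3)
proof (induction rule: finite_induct)
  case empty
  then show ?case
    using \<open>0 < k\<close> by (simp add: zero_L)
next
  case (insert i F)
  have f: "f j \<in> carrier L" if "j \<in> insert i F" for j
    using insert.prems that by (simp add: series_component_def)
  have "(\<Oplus>\<^bsub>L\<^esub>i\<in>insert i F. f i) k = (f i \<oplus>\<^bsub>L\<^esub> (\<Oplus>\<^bsub>L\<^esub>i\<in>F. f i)) k"
    using insert.hyps f by (subst L.finsum_insert) auto
  also have "\<dots> = f i k \<otimes>\<^bsub>factor k\<^esub> (if k \<in> F then f k k else \<one>\<^bsub>factor k\<^esub>)"
    using insert \<open>0 < k\<close> by (simp add: add_L)
  also have "\<dots> = (if k \<in> insert i F then f k k else \<one>\<^bsub>factor k\<^esub>)"
  proof -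
    have "f i k = \<one>\<^bsub>factor k\<^esub>" if "k \<noteq> i"
      using insert.prems(2)[of i] that \<open>0 < k\<close> by (simp add: series_component_def)
    then show ?thesis
      using insert.hyps(2) \<open>0 < k\<close> factor_group[of k, THEN group.is_monoid] L_coord[OF f \<open>0 < k\<close>]
      by (cases "k = i") (auto simp: monoid.l_one monoid.r_one)
  qed
  finally show ?case .
qed

lemma decomposition:
  assumes u: "u \<in> carrier L"
  shows "\<exists>!f. f \<in> (\<Pi>\<^sub>E i\<in>{0<..}. series_component H S i) \<and> finite {i \<in> {0<..}. f i \<noteq> \<zero>\<^bsub>L\<^esub>} \<and>
               u = (\<Oplus>\<^bsub>L\<^esub>i\<in>{i \<in> {0<..}. f i \<noteq> \<zero>\<^bsub>L\<^esub>}. f i)"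
proof (rule ex_ex1I)
  have coord: "u k = f k k"
    if f: "f \<in> (\<Pi>\<^sub>E i\<in>{0<..}. series_component H S i)" "finite {i \<in> {0<..}. f i \<noteq> \<zero>\<^bsub>L\<^esub>}"
      "u = (\<Oplus>\<^bsub>L\<^esub>i\<in>{i \<in> {0<..}. f i \<noteq> \<zero>\<^bsub>L\<^esub>}. f i)" and k: "0 < k" for f k
  proof -
    have "u k = (if k \<in> {i \<in> {0<..}. f i \<noteq> \<zero>\<^bsub>L\<^esub>} then f k k else \<one>\<^bsub>factor k\<^esub>)"
      unfolding f(3) by (rule finsum_coord) (use f k in auto)
    then show ?thesis
      using k by (auto simp: zero_L)
  qed
  show "f = g"
    if "f \<in> (\<Pi>\<^sub>E i\<in>{0<..}. series_component H S i) \<and> finite {i \<in> {0<..}. f i \<noteq> \<zero>\<^bsub>L\<^esub>} \<and>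
               u = (\<Oplus>\<^bsub>L\<^esub>i\<in>{i \<in> {0<..}. f i \<noteq> \<zero>\<^bsub>L\<^esub>}. f i)"
      "g \<in> (\<Pi>\<^sub>E i\<in>{0<..}. series_component H S i) \<and> finite {i \<in> {0<..}. g i \<noteq> \<zero>\<^bsub>L\<^esub>} \<and>
               u = (\<Oplus>\<^bsub>L\<^esub>i\<in>{i \<in> {0<..}. g i \<noteq> \<zero>\<^bsub>L\<^esub>}. g i)" for f g
  proof -
    have "f i i = g i i" if "0 < i" for i
      using that coord[of f i] coord[of g i] \<open>f \<in> _ \<and> _\<close> \<open>g \<in> _ \<and> _\<close> by metis
    moreover have "f i \<in> series_component H S i" "g i \<in> series_component H S i" if "0 < i" for i
      using that \<open>f \<in> _ \<and> _\<close> \<open>g \<in> _ \<and> _\<close> by auto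
    ultimately have "f i = g i" if "0 < i" for i
      using that by (intro L_eqI) (simp_all add: series_component_def, metis)
    then show ?thesis
      using that by (auto intro: PiE_ext)
  qed
  have "\<exists>x\<in>S i. u i = S (Suc i) #> x" if "0 < i" for i
    using L_coord_rep[OF u that] by metis
  then obtain r where r: "\<And>i. 0 < i \<Longrightarrow> r i \<in> S i" "\<And>i. 0 < i \<Longrightarrow> u i = S (Suc i) #> r i"
    by metis
  define f where "f = (\<lambda>i\<in>{0<..}. cls i (r i))"
  have f: "f \<in> (\<Pi>\<^sub>E i\<in>{0<..}. series_component H S i)"
    using r by (auto simp: f_def series_component_eq)
  have "f i = \<zero>\<^bsub>L\<^esub> \<longleftrightarrow> u i = \<one>\<^bsub>factor i\<^esub>" if "0 < i" for i
    using that r by (simp add: f_def cls_eq_zero_iff rcos_eq_one_iff)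
  then have supp: "{i \<in> {0<..}. f i \<noteq> \<zero>\<^bsub>L\<^esub>} = {i \<in> {0<..}. u i \<noteq> \<one>\<^bsub>factor i\<^esub>}"
    by auto
  then have fin: "finite {i \<in> {0<..}. f i \<noteq> \<zero>\<^bsub>L\<^esub>}"
    using u by (simp add: carrier_L)
  have "u = (\<Oplus>\<^bsub>L\<^esub>i\<in>{i \<in> {0<..}. f i \<noteq> \<zero>\<^bsub>L\<^esub>}. f i)"
  proof (rule L_eqI[OF u])
    show "(\<Oplus>\<^bsub>L\<^esub>i\<in>{i \<in> {0<..}. f i \<noteq> \<zero>\<^bsub>L\<^esub>}. f i) \<in> carrier L"
      using f by (intro L.finsum_closed) (auto simp: series_component_def)
    fix k :: nat assume k: "0 < k"
    have "(\<Oplus>\<^bsub>L\<^esub>i\<in>{i \<in> {0<..}. f i \<noteq> \<zero>\<^bsub>L\<^esub>}. f i) k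
        = (if k \<in> {i \<in> {0<..}. f i \<noteq> \<zero>\<^bsub>L\<^esub>} then f k k else \<one>\<^bsub>factor k\<^esub>)"
      by (rule finsum_coord) (use f fin k in auto)
    also have "\<dots> = u k"
      unfolding supp using k r by (auto simp: f_def cls_apply)
    finally show "u k = (\<Oplus>\<^bsub>L\<^esub>i\<in>{i \<in> {0<..}. f i \<noteq> \<zero>\<^bsub>L\<^esub>}. f i) k" ..
  qed
  with f fin show "\<exists>f. f \<in> (\<Pi>\<^sub>E i\<in>{0<..}. series_component H S i) \<and> finite {i \<in> {0<..}. f i \<noteq> \<zero>\<^bsub>L\<^esub>} \<and>
               u = (\<Oplus>\<^bsub>L\<^esub>i\<in>{i \<in> {0<..}. f i \<noteq> \<zero>\<^bsub>L\<^esub>}. f i)"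
    by blast
qed

text \<open>The universal property of the direct sum, from which the derivations \<open>D\<^sub>a\<close> and the
  homomorphism into the derivation ring both arise. The hypotheses make \<open>f i\<close> constant on classes;
  \<open>F\<close> sums its values at representatives of the nonzero coordinates.\<close>

lemma additive_extension:
  assumes "abelian_group M"
    and closed: "\<And>i x. \<lbrakk>0 < i; x \<in> S i\<rbrakk> \<Longrightarrow> f i x \<in> carrier M"
    and mult: "\<And>i x y. \<lbrakk>0 < i; x \<in> S i; y \<in> S i\<rbrakk> \<Longrightarrow> f i (x \<otimes> y) = f i x \<oplus>\<^bsub>M\<^esub> f i y"
    and zero: "\<And>i x. \<lbrakk>0 < i; x \<in> S (Suc i)\<rbrakk> \<Longrightarrow> f i x = \<zero>\<^bsub>M\<^esub>"
  obtains F where "F \<in> extensional (carrier L)" "F \<in> hom (add_monoid L) (add_monoid M)"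
    "\<And>i x. \<lbrakk>0 < i; x \<in> S i\<rbrakk> \<Longrightarrow> F (cls i x) = f i x"
proof -
  interpret M: abelian_group M
    by fact
  have f_eq: "f i x = f i y" if "0 < i" "x \<in> S i" "y \<in> S i" "S (Suc i) #> x = S (Suc i) #> y" for i x y
  proof -
    interpret N: normal "S (Suc i)" H
      by (simp add: series_normal)
    define z where "z = inv x \<otimes> y"
    have z: "z \<in> S (Suc i)"
      unfolding z_def using that N.rcos_eq_iff[of x y] series_carrier by blast
    then have "z \<in> S i"
      using that series_Suc_subset by blast
    moreover have "y = x \<otimes> z"
      using that by (simp add: z_def word_simps series_carrier)
    ultimately show ?thesis
      using that z mult[of i x z] zero[of i z] closed[of i x] by simp
  qed
  define rep where "rep u k = (SOME x. x \<in> S k \<and> u k = S (Suc k) #> x)" for u k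
  have rep: "rep u k \<in> S k \<and> u k = S (Suc k) #> rep u k" if u: "u \<in> carrier L" and k: "0 < k" for u k
  proof -
    obtain x where "x \<in> S k \<and> u k = S (Suc k) #> x"
      by (rule L_coord_rep[OF u k]) blast
    then show ?thesis
      unfolding rep_def by (rule someI)
  qed
  define supp where "supp u = {k \<in> {0<..}. u k \<noteq> \<one>\<^bsub>factor k\<^esub>}" for u
  define F where "F = (\<lambda>u\<in>carrier L. \<Oplus>\<^bsub>M\<^esub>k\<in>supp u. f k (rep u k))"
  have F: "F u = (\<Oplus>\<^bsub>M\<^esub>k\<in>T. f k (rep u k))"
    if u: "u \<in> carrier L" and T: "finite T" "supp u \<subseteq> T" "T \<subseteq> {0<..}" for u T
  proof -
    have "f k (rep u k) = \<zero>\<^bsub>M\<^esub>" if "k \<in> T - supp u" for k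
    proof -
      have k: "0 < k" "u k = \<one>\<^bsub>factor k\<^esub>"
        using that T by (auto simp: supp_def)
      then show ?thesis
        using rep[OF u, of k] rcos_eq_one_iff zero by metis
    qed
    then have "(\<Oplus>\<^bsub>M\<^esub>k\<in>supp u. f k (rep u k)) = (\<Oplus>\<^bsub>M\<^esub>k\<in>T. f k (rep u k))"
      using T rep[OF u] closed by (intro M.add.finprod_mono_neutral_cong_left) auto
    then show ?thesis
      using u by (simp add: F_def)
  qed
  show ?thesis
  proof
    show "F \<in> extensional (carrier L)"
      by (simp add: F_def)
    show "F \<in> hom (add_monoid L) (add_monoid M)"
    proof (rule homI; simp)
      fix u assume u: "u \<in> carrier L"
      then show "F u \<in> carrier M"
        using rep[OF u] closed by (auto simp: F_def supp_def intro!: M.finsum_closed)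
      fix v assume v: "v \<in> carrier L"
      define T where "T = supp u \<union> supp v"
      have T: "finite T" "supp u \<subseteq> T" "supp v \<subseteq> T" "T \<subseteq> {0<..}"
        using u v by (auto simp: T_def supp_def carrier_L)
      have "supp (u \<oplus>\<^bsub>L\<^esub> v) \<subseteq> T"
        using factor_one_mult_one
        by (auto simp: T_def supp_def add_L)
      moreover have "f k (rep (u \<oplus>\<^bsub>L\<^esub> v) k) = f k (rep u k) \<oplus>\<^bsub>M\<^esub> f k (rep v k)" if "k \<in> T" for k
      proof -
        have k: "0 < k"
          using that T by auto
        have "S (Suc k) #> rep (u \<oplus>\<^bsub>L\<^esub> v) k = u k \<otimes>\<^bsub>factor k\<^esub> v k"
          using rep[OF L.a_closed[OF u v] k] k by (simp add: add_L)
        also have "\<dots> = S (Suc k) #> (rep u k \<otimes> rep v k)"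
          using rep[OF u k] rep[OF v k] k mult_factor_rcos by metis
        finally show ?thesis
          using rep[OF L.a_closed[OF u v] k] rep[OF u k] rep[OF v k] k mult
            f_eq[of k "rep (u \<oplus>\<^bsub>L\<^esub> v) k" "rep u k \<otimes> rep v k"] series_mult
          by simp
      qed
      ultimately have "F (u \<oplus>\<^bsub>L\<^esub> v) = (\<Oplus>\<^bsub>M\<^esub>k\<in>T. f k (rep u k) \<oplus>\<^bsub>M\<^esub> f k (rep v k))"
        using F[OF L.a_closed[OF u v], of T] T rep[OF u] rep[OF v] closed
        by (auto intro!: M.finsum_cong')
      also have "\<dots> = F u \<oplus>\<^bsub>M\<^esub> F v"
        using F[OF u, of T] F[OF v, of T] T rep[OF u] rep[OF v] closed
        by (subst M.finsum_addf) auto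
      finally show "F (u \<oplus>\<^bsub>L\<^esub> v) = F u \<oplus>\<^bsub>M\<^esub> F v" .
    qed
    fix i :: nat and x assume ix: "0 < i" "x \<in> S i"
    have cl: "cls i x \<in> carrier L"
      using ix by blast
    have supp: "supp (cls i x) \<subseteq> {i}"
      by (auto simp: supp_def cls_apply)
    have "f i (rep (cls i x) i) = f i x"
      using rep[OF cl ix(1)] ix by (intro f_eq) (auto simp: cls_apply)
    then show "F (cls i x) = f i x"
      using F[OF cl, of "{i}"] ix rep[OF cl ix(1)] closed supp by simp
  qed
qed

end

section \<open>The Lie product\<close>

text \<open>Stated for functions that are additive on a carrier, so that it applies to the maps
  \<open>u \<mapsto> u \<circ> v\<close> and \<open>v \<mapsto> u \<circ> v\<close> as well as to derivations.\<close>

lemma additive_minus: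
  assumes "abelian_group R" "abelian_group M"
    and closed: "\<And>u. u \<in> carrier R \<Longrightarrow> f u \<in> carrier M"
    and add: "\<And>u v. \<lbrakk>u \<in> carrier R; v \<in> carrier R\<rbrakk> \<Longrightarrow> f (u \<oplus>\<^bsub>R\<^esub> v) = f u \<oplus>\<^bsub>M\<^esub> f v"
    and u: "u \<in> carrier R"
  shows "f (\<ominus>\<^bsub>R\<^esub> u) = \<ominus>\<^bsub>M\<^esub> f u"
proof -
  interpret f: group_hom "add_monoid R" "add_monoid M" f
    using assms by (intro group_hom.intro group_hom_axioms.intro abelian_group.a_group homI) auto
  show ?thesis
    using f.hom_inv[of u] u by (simp add: a_inv_def)
qed

context strongly_central_series
begin

lemma bracket_coord_closed:
  assumes "u \<in> carrier L" "v \<in> carrier L" "i \<in> {0<..<k}"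
  shows "bracket i (k - i) (u i) (v (k - i)) \<in> carrier (factor k)"
  using bracket_closed[of i "k - i" "u i" "v (k - i)"] assms by (simp add: L_coord)

lemma mult_L_closed:
  assumes u: "u \<in> carrier L" and v: "v \<in> carrier L"
  shows "u \<otimes>\<^bsub>L\<^esub> v \<in> carrier L"
proof -
  obtain m n where m: "\<forall>k\<in>{k \<in> {0<..}. u k \<noteq> \<one>\<^bsub>factor k\<^esub>}. k \<le> m"
    and n: "\<forall>k\<in>{k \<in> {0<..}. v k \<noteq> \<one>\<^bsub>factor k\<^esub>}. k \<le> n"
    using u v by (auto simp: carrier_L finite_nat_set_iff_bounded_le)
  have "(u \<otimes>\<^bsub>L\<^esub> v) k = \<one>\<^bsub>factor k\<^esub>" if "m + n < k" for k
  proof -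
    interpret Q: comm_group "factor k"
      using that by (intro factor_comm_group) simp
    have "bracket i (k - i) (u i) (v (k - i)) = \<one>\<^bsub>factor k\<^esub>" if i: "i \<in> {0<..<k}" for i
    proof (cases "i \<le> m")
      case True
      then have "v (k - i) = \<one>\<^bsub>factor (k - i)\<^esub>"
        using bspec[OF n, of "k - i"] i \<open>m + n < k\<close> by (auto simp: le_diff_conv)
      then show ?thesis
        using i bracket_one_right[of "k - i" i "u i"] L_coord[OF u] by simp
    next
      case False
      then have "u i = \<one>\<^bsub>factor i\<^esub>"
        using bspec[OF m, of i] i by auto
      then show ?thesis
        using i bracket_one_left[of i "k - i" "v (k - i)"] L_coord[OF v] by simp
    qed
    then have "finprod (factor k) (\<lambda>i. bracket i (k - i) (u i) (v (k - i))) {0<..<k} = \<one>\<^bsub>factor k\<^esub>"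
      by (intro Q.finprod_one_eqI)
    then show ?thesis
      using that by (simp add: mult_L)
  qed
  then have "{k \<in> {0<..}. (u \<otimes>\<^bsub>L\<^esub> v) k \<noteq> \<one>\<^bsub>factor k\<^esub>} \<subseteq> {..m + n}"
    using not_le by blast
  then have "finite {k \<in> {0<..}. (u \<otimes>\<^bsub>L\<^esub> v) k \<noteq> \<one>\<^bsub>factor k\<^esub>}"
    by (rule finite_subset) simp
  moreover have "(u \<otimes>\<^bsub>L\<^esub> v) k \<in> carrier (factor k)" if k: "0 < k" for k
  proof -
    interpret Q: comm_group "factor k"
      by (rule factor_comm_group[OF k])
    show ?thesis
      using k bracket_coord_closed[OF u v] by (auto simp: mult_L intro!: Q.finprod_closed)
  qed
  ultimately show ?thesis
    by (auto simp: carrier_L mult_L)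
qed

lemma mult_L_add_left:
  assumes u: "u \<in> carrier L" and v: "v \<in> carrier L" and w: "w \<in> carrier L"
  shows "(u \<oplus>\<^bsub>L\<^esub> v) \<otimes>\<^bsub>L\<^esub> w = (u \<otimes>\<^bsub>L\<^esub> w) \<oplus>\<^bsub>L\<^esub> (v \<otimes>\<^bsub>L\<^esub> w)"
proof (rule L_eqI)
  fix k :: nat assume k: "0 < k"
  interpret Q: comm_group "factor k"
    by (rule factor_comm_group[OF k])
  have "((u \<oplus>\<^bsub>L\<^esub> v) \<otimes>\<^bsub>L\<^esub> w) k = finprod (factor k)
      (\<lambda>i. bracket i (k - i) (u i) (w (k - i)) \<otimes>\<^bsub>factor k\<^esub> bracket i (k - i) (v i) (w (k - i))) {0<..<k}"
  proof -
    have "bracket i (k - i) ((u \<oplus>\<^bsub>L\<^esub> v) i) (w (k - i))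
        = bracket i (k - i) (u i) (w (k - i)) \<otimes>\<^bsub>factor k\<^esub> bracket i (k - i) (v i) (w (k - i))"
      if "i \<in> {0<..<k}" for i
      using that bracket_mult_left[of i "k - i" "u i" "v i" "w (k - i)"] L_coord[OF u] L_coord[OF v] L_coord[OF w]
      by (simp add: add_L)
    then have "finprod (factor k) (\<lambda>i. bracket i (k - i) ((u \<oplus>\<^bsub>L\<^esub> v) i) (w (k - i))) {0<..<k} = finprod (factor k)
      (\<lambda>i. bracket i (k - i) (u i) (w (k - i)) \<otimes>\<^bsub>factor k\<^esub> bracket i (k - i) (v i) (w (k - i))) {0<..<k}"
      using bracket_coord_closed[OF u w] bracket_coord_closed[OF v w]
      by (intro Q.finprod_cong' Pi_I Q.m_closed) auto
    then show ?thesis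
      unfolding mult_L using k by simp
  qed
  also have "\<dots> = ((u \<otimes>\<^bsub>L\<^esub> w) \<oplus>\<^bsub>L\<^esub> (v \<otimes>\<^bsub>L\<^esub> w)) k"
    using k bracket_coord_closed[OF u w] bracket_coord_closed[OF v w]
    by (subst Q.finprod_multf) (auto simp: mult_L add_L)
  finally show "((u \<oplus>\<^bsub>L\<^esub> v) \<otimes>\<^bsub>L\<^esub> w) k = ((u \<otimes>\<^bsub>L\<^esub> w) \<oplus>\<^bsub>L\<^esub> (v \<otimes>\<^bsub>L\<^esub> w)) k" .
qed (use u v w in \<open>auto intro!: mult_L_closed\<close>)

lemma mult_L_add_right:
  assumes u: "u \<in> carrier L" and v: "v \<in> carrier L" and w: "w \<in> carrier L"
  shows "u \<otimes>\<^bsub>L\<^esub> (v \<oplus>\<^bsub>L\<^esub> w) = (u \<otimes>\<^bsub>L\<^esub> v) \<oplus>\<^bsub>L\<^esub> (u \<otimes>\<^bsub>L\<^esub> w)"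
proof (rule L_eqI)
  fix k :: nat assume k: "0 < k"
  interpret Q: comm_group "factor k"
    by (rule factor_comm_group[OF k])
  have "(u \<otimes>\<^bsub>L\<^esub> (v \<oplus>\<^bsub>L\<^esub> w)) k = finprod (factor k)
      (\<lambda>i. bracket i (k - i) (u i) (v (k - i)) \<otimes>\<^bsub>factor k\<^esub> bracket i (k - i) (u i) (w (k - i))) {0<..<k}"
  proof -
    have "bracket i (k - i) (u i) ((v \<oplus>\<^bsub>L\<^esub> w) (k - i))
        = bracket i (k - i) (u i) (v (k - i)) \<otimes>\<^bsub>factor k\<^esub> bracket i (k - i) (u i) (w (k - i))"
      if "i \<in> {0<..<k}" for i
      using that bracket_mult_right[of "k - i" i "v (k - i)" "w (k - i)" "u i"]
        L_coord[OF u] L_coord[OF v] L_coord[OF w]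
      by (simp add: add_L)
    then have "finprod (factor k) (\<lambda>i. bracket i (k - i) (u i) ((v \<oplus>\<^bsub>L\<^esub> w) (k - i))) {0<..<k} = finprod (factor k)
      (\<lambda>i. bracket i (k - i) (u i) (v (k - i)) \<otimes>\<^bsub>factor k\<^esub> bracket i (k - i) (u i) (w (k - i))) {0<..<k}"
      using bracket_coord_closed[OF u v] bracket_coord_closed[OF u w]
      by (intro Q.finprod_cong' Pi_I Q.m_closed) auto
    then show ?thesis
      unfolding mult_L using k by simp
  qed
  also have "\<dots> = ((u \<otimes>\<^bsub>L\<^esub> v) \<oplus>\<^bsub>L\<^esub> (u \<otimes>\<^bsub>L\<^esub> w)) k"
    using k bracket_coord_closed[OF u v] bracket_coord_closed[OF u w]
    by (subst Q.finprod_multf) (auto simp: mult_L add_L)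
  finally show "(u \<otimes>\<^bsub>L\<^esub> (v \<oplus>\<^bsub>L\<^esub> w)) k = ((u \<otimes>\<^bsub>L\<^esub> v) \<oplus>\<^bsub>L\<^esub> (u \<otimes>\<^bsub>L\<^esub> w)) k" .
qed (use u v w in \<open>auto intro!: mult_L_closed\<close>)

text \<open>In the sum that defines coordinate \<open>k\<close> at most the summand \<open>(i, k - i)\<close> is nonzero, and only
  if \<open>k = i + j\<close>.\<close>

lemma mult_L_cls:
  assumes ij: "0 < i" "0 < j" and x: "x \<in> S i" and y: "y \<in> S j"
  shows "cls i x \<otimes>\<^bsub>L\<^esub> cls j y = cls (i + j) (commutator H x y)"
proof (rule L_eqI)
  have cx: "cls i x \<in> carrier L" and cy: "cls j y \<in> carrier L"
    using assms by auto
  then show "cls i x \<otimes>\<^bsub>L\<^esub> cls j y \<in> carrier L"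
    by (rule mult_L_closed)
  show "cls (i + j) (commutator H x y) \<in> carrier L"
    using assms series_commutator by auto
  fix k :: nat assume k: "0 < k"
  interpret Q: comm_group "factor k"
    by (rule factor_comm_group[OF k])
  define b where "b = (\<lambda>l. bracket l (k - l) (cls i x l) (cls j y (k - l)))"
  have b: "(cls i x \<otimes>\<^bsub>L\<^esub> cls j y) k = finprod (factor k) b {0<..<k}"
    using k by (simp add: mult_L b_def)
  have b_closed: "b \<in> {0<..<k} \<rightarrow> carrier (factor k)"
    using bracket_coord_closed[OF cx cy] by (auto simp: b_def)
  have b_one: "b l = \<one>\<^bsub>factor k\<^esub>" if l: "l \<in> {0<..<k}" "\<not> (l = i \<and> k = i + j)" for l
  proof (cases "l = i")
    case True
    then have "cls j y (k - l) = \<one>\<^bsub>factor (k - l)\<^esub>"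
      using l by (auto simp: cls_apply)
    then show ?thesis
      using l bracket_one_right[of "k - l" l "cls i x l"] L_coord[OF cx, of l] by (simp add: b_def)
  next
    case False
    then have "cls i x l = \<one>\<^bsub>factor l\<^esub>"
      using l by (simp add: cls_apply)
    then show ?thesis
      using l bracket_one_left[of l "k - l" "cls j y (k - l)"] L_coord[OF cy, of "k - l"]
      by (simp add: b_def)
  qed
  show "(cls i x \<otimes>\<^bsub>L\<^esub> cls j y) k = cls (i + j) (commutator H x y) k"
  proof (cases "k = i + j")
    case True
    have "finprod (factor k) b {0<..<k}
        = finprod (factor k) (\<lambda>l. if i = l then b l else \<one>\<^bsub>factor k\<^esub>) {0<..<k}"
      using b_closed b_one by (intro Q.finprod_cong') auto
    also have "\<dots> = b i"
      using b_closed ij True by (intro Q.finprod_singleton) auto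
    also have "\<dots> = S (Suc (i + j)) #> commutator H x y"
      using True assms bracket_rcos by (simp add: b_def cls_apply)
    finally show ?thesis
      using True k b by (simp add: cls_apply)
  next
    case False
    then have "finprod (factor k) b {0<..<k} = \<one>\<^bsub>factor k\<^esub>"
      using b_one by (intro Q.finprod_one_eqI) auto
    then show ?thesis
      using False k by (simp add: b cls_apply)
  qed
qed

lemma mult_L_minus_left:
  "\<lbrakk>u \<in> carrier L; v \<in> carrier L\<rbrakk> \<Longrightarrow> (\<ominus>\<^bsub>L\<^esub> u) \<otimes>\<^bsub>L\<^esub> v = \<ominus>\<^bsub>L\<^esub> (u \<otimes>\<^bsub>L\<^esub> v)"
  using additive_minus[OF abelian_group_L abelian_group_L, of "\<lambda>u. u \<otimes>\<^bsub>L\<^esub> v"]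
  by (simp add: mult_L_closed mult_L_add_left)

lemma mult_L_minus_right:
  "\<lbrakk>u \<in> carrier L; v \<in> carrier L\<rbrakk> \<Longrightarrow> u \<otimes>\<^bsub>L\<^esub> (\<ominus>\<^bsub>L\<^esub> v) = \<ominus>\<^bsub>L\<^esub> (u \<otimes>\<^bsub>L\<^esub> v)"
  using additive_minus[OF abelian_group_L abelian_group_L, of "\<lambda>v. u \<otimes>\<^bsub>L\<^esub> v"]
  by (simp add: mult_L_closed mult_L_add_right)

text \<open>On classes this is \<open>[y, x] = [x, y]\<inverse>\<close>. It makes the mixed terms of
  \<open>(u + v) \<circ> (u + v)\<close> cancel.\<close>

lemma mult_L_anticommute:
  assumes "u \<in> carrier L" "v \<in> carrier L"
  shows "u \<otimes>\<^bsub>L\<^esub> v \<oplus>\<^bsub>L\<^esub> v \<otimes>\<^bsub>L\<^esub> u = \<zero>\<^bsub>L\<^esub>"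
  using assms
proof (induction u rule: L_induct)
  case (cls i x)
  from cls(3) show ?case
  proof (induction v rule: L_induct)
    case (cls j y)
    then have "cls i x \<otimes>\<^bsub>L\<^esub> cls j y = \<ominus>\<^bsub>L\<^esub> (cls j y \<otimes>\<^bsub>L\<^esub> cls i x)"
      using \<open>0 < i\<close> \<open>x \<in> S i\<close> series_commutator[of j i y x] inv_commutator[of y x] series_carrier
      by (simp add: mult_L_cls add.commute flip: cls_inv)
    then show ?case
      using cls \<open>0 < i\<close> \<open>x \<in> S i\<close> by (simp add: L.l_neg mult_L_closed cls_closed)
  next
    case (add v w)
    then show ?case
      using cls_closed[OF \<open>0 < i\<close> \<open>x \<in> S i\<close>] L.add.m_comm L.a_ac mult_L_closed
      by (simp add: mult_L_add_left mult_L_add_right)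
  qed
next
  case (add u w)
  then have "(u \<oplus>\<^bsub>L\<^esub> w) \<otimes>\<^bsub>L\<^esub> v \<oplus>\<^bsub>L\<^esub> v \<otimes>\<^bsub>L\<^esub> (u \<oplus>\<^bsub>L\<^esub> w)
      = (u \<otimes>\<^bsub>L\<^esub> v \<oplus>\<^bsub>L\<^esub> v \<otimes>\<^bsub>L\<^esub> u) \<oplus>\<^bsub>L\<^esub> (w \<otimes>\<^bsub>L\<^esub> v \<oplus>\<^bsub>L\<^esub> v \<otimes>\<^bsub>L\<^esub> w)"
    by (simp add: mult_L_add_left mult_L_add_right mult_L_closed L.a_ac)
  then show ?case
    using add by simp
qed

lemma mult_L_self:
  assumes "u \<in> carrier L"
  shows "u \<otimes>\<^bsub>L\<^esub> u = \<zero>\<^bsub>L\<^esub>"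
  using assms
proof (induction u rule: L_induct)
  case (cls i x)
  then show ?case
    by (simp add: mult_L_cls commutator_self series_carrier cls_eq_zero_iff series_one)
next
  case (add u v)
  then have "(u \<oplus>\<^bsub>L\<^esub> v) \<otimes>\<^bsub>L\<^esub> (u \<oplus>\<^bsub>L\<^esub> v)
      = (u \<otimes>\<^bsub>L\<^esub> u \<oplus>\<^bsub>L\<^esub> v \<otimes>\<^bsub>L\<^esub> v) \<oplus>\<^bsub>L\<^esub> (u \<otimes>\<^bsub>L\<^esub> v \<oplus>\<^bsub>L\<^esub> v \<otimes>\<^bsub>L\<^esub> u)"
    by (simp add: mult_L_add_left mult_L_add_right mult_L_closed L.a_ac)
  then show ?case
    using add mult_L_anticommute by simp
qed

text \<open>Conjugation does not change classes, and inverting one entry of a commutator changes the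
  sign of its class. So the classes of the three factors in the Hall--Witt identity are the negatives
  of the three terms of the Jacobi identity.\<close>

lemma jacobi_cls:
  assumes ijk: "0 < i" "0 < j" "0 < k" and xyz: "x \<in> S i" "y \<in> S j" "z \<in> S k"
  shows "(cls i x \<otimes>\<^bsub>L\<^esub> cls j y) \<otimes>\<^bsub>L\<^esub> cls k z \<oplus>\<^bsub>L\<^esub> (cls j y \<otimes>\<^bsub>L\<^esub> cls k z) \<otimes>\<^bsub>L\<^esub> cls i x
    \<oplus>\<^bsub>L\<^esub> (cls k z \<otimes>\<^bsub>L\<^esub> cls i x) \<otimes>\<^bsub>L\<^esub> cls j y = \<zero>\<^bsub>L\<^esub>"
proof -
  have conj: "inv q \<otimes> commutator H (commutator H p (inv q)) r \<otimes> q \<in> S (l + m + n) \<and>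
     cls (l + m + n) (inv q \<otimes> commutator H (commutator H p (inv q)) r \<otimes> q)
      = \<ominus>\<^bsub>L\<^esub> ((cls l p \<otimes>\<^bsub>L\<^esub> cls m q) \<otimes>\<^bsub>L\<^esub> cls n r)"
    if lmn: "0 < l" "0 < m" "0 < n" and pqr: "p \<in> S l" "q \<in> S m" "r \<in> S n" for l m n p q r
  proof -
    have q: "inv q \<in> S m" "q \<in> S 1" "q \<in> carrier H"
      using lmn pqr series_inv series_mem_mono[of q m 1] series_carrier by auto
    have 1: "commutator H p (inv q) \<in> S (l + m)"
      using lmn pqr q by (intro series_commutator) auto
    then have 2: "commutator H (commutator H p (inv q)) r \<in> S (l + m + n)"
      using lmn pqr q by (intro series_commutator) auto
    then have "cls (l + m + n) (inv q \<otimes> commutator H (commutator H p (inv q)) r \<otimes> q)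
        = (cls l p \<otimes>\<^bsub>L\<^esub> cls m (inv q)) \<otimes>\<^bsub>L\<^esub> cls n r"
      using lmn pqr q 1 by (simp add: cls_conj[OF _ _ q(2)] mult_L_cls)
    then show ?thesis
      using lmn pqr q 2
      by (simp add: cls_inv mult_L_minus_left mult_L_minus_right mult_L_closed cls_closed series_conj)
  qed
  let ?a = "inv y \<otimes> commutator H (commutator H x (inv y)) z \<otimes> y"
  let ?b = "inv z \<otimes> commutator H (commutator H y (inv z)) x \<otimes> z"
  let ?c = "inv x \<otimes> commutator H (commutator H z (inv x)) y \<otimes> x"
  let ?J = "(cls i x \<otimes>\<^bsub>L\<^esub> cls j y) \<otimes>\<^bsub>L\<^esub> cls k z \<oplus>\<^bsub>L\<^esub> (cls j y \<otimes>\<^bsub>L\<^esub> cls k z) \<otimes>\<^bsub>L\<^esub> cls i x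
    \<oplus>\<^bsub>L\<^esub> (cls k z \<otimes>\<^bsub>L\<^esub> cls i x) \<otimes>\<^bsub>L\<^esub> cls j y"
  have a: "?a \<in> S (i + j + k)" "cls (i + j + k) ?a = \<ominus>\<^bsub>L\<^esub> ((cls i x \<otimes>\<^bsub>L\<^esub> cls j y) \<otimes>\<^bsub>L\<^esub> cls k z)"
    using conj[OF ijk xyz] by auto
  have "j + k + i = i + j + k" "k + i + j = i + j + k"
    by simp_all
  then have b: "?b \<in> S (i + j + k)" "cls (i + j + k) ?b = \<ominus>\<^bsub>L\<^esub> ((cls j y \<otimes>\<^bsub>L\<^esub> cls k z) \<otimes>\<^bsub>L\<^esub> cls i x)"
    and c: "?c \<in> S (i + j + k)" "cls (i + j + k) ?c = \<ominus>\<^bsub>L\<^esub> ((cls k z \<otimes>\<^bsub>L\<^esub> cls i x) \<otimes>\<^bsub>L\<^esub> cls j y)"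
    using conj[OF ijk(2,3,1) xyz(2,3,1)] conj[OF ijk(3,1,2) xyz(3,1,2)] by metis+
  have "\<ominus>\<^bsub>L\<^esub> ?J = cls (i + j + k) ?a \<oplus>\<^bsub>L\<^esub> cls (i + j + k) ?b \<oplus>\<^bsub>L\<^esub> cls (i + j + k) ?c"
    unfolding a b c using ijk xyz by (simp add: mult_L_closed cls_closed L.minus_add)
  also have "\<dots> = cls (i + j + k) (?a \<otimes> ?b \<otimes> ?c)"
    using ijk a(1) b(1) c(1) by (simp add: cls_mult series_mult)
  also have "\<dots> = \<zero>\<^bsub>L\<^esub>"
    using hall_witt[of x y z] series_carrier[OF xyz(1) ijk(1)] series_carrier[OF xyz(2) ijk(2)]
      series_carrier[OF xyz(3) ijk(3)] cls_eq_zero_iff[of "i + j + k" \<one>] ijk series_one by simp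
  finally have J: "\<ominus>\<^bsub>L\<^esub> ?J = \<zero>\<^bsub>L\<^esub>" .
  have "?J \<in> carrier L"
    using ijk xyz by (simp add: mult_L_closed cls_closed)
  then show ?thesis
    using J by (rule iffD1[OF L.add.inv_eq_1_iff])
qed

lemma jacobi_L:
  assumes u: "u \<in> carrier L" and v: "v \<in> carrier L" and w: "w \<in> carrier L"
  shows "(u \<otimes>\<^bsub>L\<^esub> v) \<otimes>\<^bsub>L\<^esub> w \<oplus>\<^bsub>L\<^esub> (v \<otimes>\<^bsub>L\<^esub> w) \<otimes>\<^bsub>L\<^esub> u \<oplus>\<^bsub>L\<^esub> (w \<otimes>\<^bsub>L\<^esub> u) \<otimes>\<^bsub>L\<^esub> v = \<zero>\<^bsub>L\<^esub>"
    (is "?J u v w = _")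
proof -
  have J_add: "?J (p \<oplus>\<^bsub>L\<^esub> q) r s = ?J p r s \<oplus>\<^bsub>L\<^esub> ?J q r s"
    "?J r (p \<oplus>\<^bsub>L\<^esub> q) s = ?J r p s \<oplus>\<^bsub>L\<^esub> ?J r q s"
    "?J r s (p \<oplus>\<^bsub>L\<^esub> q) = ?J r s p \<oplus>\<^bsub>L\<^esub> ?J r s q"
    if "p \<in> carrier L" "q \<in> carrier L" "r \<in> carrier L" "s \<in> carrier L" for p q r s
    using that by (simp_all add: mult_L_add_left mult_L_add_right mult_L_closed L.a_ac)
  have 1: "?J (cls i x) (cls j y) w = \<zero>\<^bsub>L\<^esub>"
    if "0 < i" "x \<in> S i" "0 < j" "y \<in> S j" for i x j y
    using w
  proof (induction w rule: L_induct)
    case (add p q)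
    then show ?case
      using that J_add by (simp add: cls_closed)
  qed (use that jacobi_cls in auto)
  have 2: "?J (cls i x) v w = \<zero>\<^bsub>L\<^esub>" if "0 < i" "x \<in> S i" for i x
    using v
  proof (induction v rule: L_induct)
    case (add p q)
    then show ?case
      using that w J_add by (simp add: cls_closed)
  qed (use that 1 in auto)
  show ?thesis
    using u
  proof (induction u rule: L_induct)
    case (add p q)
    then show ?case
      using v w J_add by simp
  qed (use 2 in auto)
qed

theorem graded_lie_ring_L: "graded_lie_ring L (series_component H S)"
proof (intro graded_lie_ring.intro graded_lie_ring_axioms.intro lie_ring.intro lie_ring_axioms.intro)
  show "abelian_group L"
    by (rule abelian_group_L)
  show "subgroup (series_component H S i) (add_monoid L)" if "0 < i" for i
  proof (rule L.add.subgroupI)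
    show "\<ominus>\<^bsub>L\<^esub> u \<in> series_component H S i" if "u \<in> series_component H S i" for u
      using that \<open>0 < i\<close> series_inv by (auto simp: series_component_eq simp flip: cls_inv)
    show "u \<oplus>\<^bsub>L\<^esub> v \<in> series_component H S i"
      if "u \<in> series_component H S i" "v \<in> series_component H S i" for u v
      using that \<open>0 < i\<close> series_mult by (auto simp: series_component_eq simp flip: cls_mult)
  qed (use that series_one in \<open>auto simp: series_component_eq\<close>)
  show "u \<otimes>\<^bsub>L\<^esub> v \<in> series_component H S (i + j)"
    if "0 < i" "0 < j" "u \<in> series_component H S i" "v \<in> series_component H S j" for i j u v
    using that series_commutator by (auto simp: series_component_eq mult_L_cls)
qed (fact mult_L_closed mult_L_add_left mult_L_add_right mult_L_self jacobi_L decomposition)+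

end

sublocale strongly_central_series \<subseteq> L: graded_lie_ring L "series_component H S"
  by (rule graded_lie_ring_L)

section \<open>The Lie ring of derivations\<close>

lemma (in abelian_group) add_minus_add:
  "\<lbrakk>a \<in> carrier G; b \<in> carrier G; c \<in> carrier G; d \<in> carrier G\<rbrakk>
    \<Longrightarrow> (a \<oplus> b) \<ominus> (c \<oplus> d) = (a \<ominus> c) \<oplus> (b \<ominus> d)"
  by (simp add: a_minus_def minus_add a_ac)

lemma (in abelian_group) minus_minus_minus:
  "\<lbrakk>a \<in> carrier G; b \<in> carrier G; c \<in> carrier G; d \<in> carrier G\<rbrakk>
    \<Longrightarrow> (a \<ominus> b) \<ominus> (c \<ominus> d) = (a \<oplus> d) \<ominus> (b \<oplus> c)"
  by (simp add: a_minus_def minus_add a_ac)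

lemma (in abelian_group) minus_self: "a \<in> carrier G \<Longrightarrow> a \<ominus> a = \<zero>"
  by (simp add: a_minus_def r_neg)

context lie_ring
begin

lemma lie_minus_left:
  "\<lbrakk>x \<in> carrier L; y \<in> carrier L\<rbrakk> \<Longrightarrow> (\<ominus> x) \<otimes> y = \<ominus> (x \<otimes> y)"
  using additive_minus[of L L "\<lambda>x. x \<otimes> y"]
  by (simp add: lie_closed lie_add_left abelian_group_axioms)

lemma lie_minus_right:
  "\<lbrakk>x \<in> carrier L; y \<in> carrier L\<rbrakk> \<Longrightarrow> x \<otimes> (\<ominus> y) = \<ominus> (x \<otimes> y)"
  using additive_minus[of L L "\<lambda>y. x \<otimes> y"]
  by (simp add: lie_closed lie_add_right abelian_group_axioms)

lemma lie_diff_left: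
  "\<lbrakk>x \<in> carrier L; y \<in> carrier L; z \<in> carrier L\<rbrakk> \<Longrightarrow> (x \<ominus> y) \<otimes> z = x \<otimes> z \<ominus> y \<otimes> z"
  by (simp add: a_minus_def lie_add_left lie_minus_left)

lemma lie_diff_right:
  "\<lbrakk>x \<in> carrier L; y \<in> carrier L; z \<in> carrier L\<rbrakk> \<Longrightarrow> z \<otimes> (x \<ominus> y) = z \<otimes> x \<ominus> z \<otimes> y"
  by (simp add: a_minus_def lie_add_right lie_minus_right)

lemma derivationI:
  assumes "D \<in> extensional (carrier L)"
    and "\<And>u. u \<in> carrier L \<Longrightarrow> D u \<in> carrier L"
    and "\<And>u v. \<lbrakk>u \<in> carrier L; v \<in> carrier L\<rbrakk> \<Longrightarrow> D (u \<oplus> v) = D u \<oplus> D v"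
    and "\<And>u v. \<lbrakk>u \<in> carrier L; v \<in> carrier L\<rbrakk> \<Longrightarrow> D (u \<otimes> v) = D u \<otimes> v \<oplus> u \<otimes> D v"
  shows "D \<in> derivations L"
  using assms by (auto simp: derivations_def hom_def PiE_def)

lemma derivation_extensional: "D \<in> derivations L \<Longrightarrow> D \<in> extensional (carrier L)"
  by (auto simp: derivations_def PiE_def)

lemma derivation_closed: "\<lbrakk>D \<in> derivations L; u \<in> carrier L\<rbrakk> \<Longrightarrow> D u \<in> carrier L"
  by (auto simp: derivations_def)

lemma derivation_add:
  "\<lbrakk>D \<in> derivations L; u \<in> carrier L; v \<in> carrier L\<rbrakk> \<Longrightarrow> D (u \<oplus> v) = D u \<oplus> D v"
  by (auto simp: derivations_def hom_def)

lemma derivation_mult: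
  "\<lbrakk>D \<in> derivations L; u \<in> carrier L; v \<in> carrier L\<rbrakk> \<Longrightarrow> D (u \<otimes> v) = D u \<otimes> v \<oplus> u \<otimes> D v"
  by (auto simp: derivations_def)

lemma derivation_minus:
  "\<lbrakk>D \<in> derivations L; u \<in> carrier L\<rbrakk> \<Longrightarrow> D (\<ominus> u) = \<ominus> D u"
  using additive_minus[of L L D]
  by (simp add: derivation_closed derivation_add abelian_group_axioms)

lemma derivation_diff:
  "\<lbrakk>D \<in> derivations L; u \<in> carrier L; v \<in> carrier L\<rbrakk> \<Longrightarrow> D (u \<ominus> v) = D u \<ominus> D v"
  by (simp add: a_minus_def derivation_add derivation_minus)

lemma derivation_eqI:
  "\<lbrakk>D \<in> derivations L; E \<in> derivations L; \<And>u. u \<in> carrier L \<Longrightarrow> D u = E u\<rbrakk> \<Longrightarrow> D = E"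
  using derivation_extensional extensionalityI by metis

abbreviation Der :: "('a \<Rightarrow> 'a) ring" where
  "Der \<equiv> der_lie_ring L"

lemma carrier_Der: "carrier Der = derivations L"
  by (simp add: der_lie_ring_def)

lemma zero_Der: "\<zero>\<^bsub>Der\<^esub> = (\<lambda>u\<in>carrier L. \<zero>)"
  by (simp add: der_lie_ring_def)

lemma add_Der: "u \<in> carrier L \<Longrightarrow> (D \<oplus>\<^bsub>Der\<^esub> E) u = D u \<oplus> E u"
  by (simp add: der_lie_ring_def)

lemma mult_Der: "u \<in> carrier L \<Longrightarrow> (D \<otimes>\<^bsub>Der\<^esub> E) u = E (D u) \<ominus> D (E u)"
  by (simp add: der_lie_ring_def)

lemma zero_derivation: "(\<lambda>u\<in>carrier L. \<zero>) \<in> derivations L"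
proof (rule derivationI)
  fix u v assume uv: "u \<in> carrier L" "v \<in> carrier L"
  have "\<zero> \<otimes> v = \<zero>" "u \<otimes> \<zero> = \<zero>"
    using uv lie_diff_left[of v v v] lie_diff_right[of u u u] by (simp_all add: minus_self lie_closed)
  then show "(\<lambda>u\<in>carrier L. \<zero>) (u \<otimes> v) = (\<lambda>u\<in>carrier L. \<zero>) u \<otimes> v \<oplus> u \<otimes> (\<lambda>u\<in>carrier L. \<zero>) v"
    using uv by (simp add: lie_closed)
qed auto

lemma minus_derivation:
  assumes D: "D \<in> derivations L"
  shows "(\<lambda>u\<in>carrier L. \<ominus> D u) \<in> derivations L"
  by (rule derivationI)
    (simp_all add: D derivation_closed derivation_add derivation_mult lie_closed minus_add
      lie_minus_left lie_minus_right)

lemma add_derivation: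
  assumes D: "D \<in> derivations L" and E: "E \<in> derivations L"
  shows "D \<oplus>\<^bsub>Der\<^esub> E \<in> derivations L"
proof (rule derivationI)
  show "D \<oplus>\<^bsub>Der\<^esub> E \<in> extensional (carrier L)"
    by (simp add: der_lie_ring_def)
qed (simp_all add: add_Der D E derivation_closed derivation_add derivation_mult lie_closed
      lie_add_left lie_add_right a_ac)

text \<open>The cross terms \<open>Du \<circ> Ev\<close> and \<open>Eu \<circ> Dv\<close> occur in both \<open>DE\<close> and \<open>ED\<close> and cancel.\<close>

lemma mult_derivation:
  assumes D: "D \<in> derivations L" and E: "E \<in> derivations L"
  shows "D \<otimes>\<^bsub>Der\<^esub> E \<in> derivations L"
proof (rule derivationI)
  show "D \<otimes>\<^bsub>Der\<^esub> E \<in> extensional (carrier L)"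
    by (simp add: der_lie_ring_def)
  fix u assume u: "u \<in> carrier L"
  then show "(D \<otimes>\<^bsub>Der\<^esub> E) u \<in> carrier L"
    by (simp add: mult_Der derivation_closed D E)
  fix v assume v: "v \<in> carrier L"
  show "(D \<otimes>\<^bsub>Der\<^esub> E) (u \<oplus> v) = (D \<otimes>\<^bsub>Der\<^esub> E) u \<oplus> (D \<otimes>\<^bsub>Der\<^esub> E) v"
    using u v by (simp add: mult_Der derivation_closed derivation_add D E add_minus_add)
  let ?s = "D u \<otimes> E v \<oplus> E u \<otimes> D v"
  have "(D \<otimes>\<^bsub>Der\<^esub> E) (u \<otimes> v)
      = ((E (D u) \<otimes> v \<oplus> u \<otimes> E (D v)) \<oplus> ?s) \<ominus> ((D (E u) \<otimes> v \<oplus> u \<otimes> D (E v)) \<oplus> ?s)"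
    using u v by (simp add: mult_Der derivation_closed derivation_add derivation_mult D E lie_closed a_ac)
  also have "\<dots> = (E (D u) \<ominus> D (E u)) \<otimes> v \<oplus> u \<otimes> (E (D v) \<ominus> D (E v))"
    using u v
    by (simp add: add_minus_add minus_self lie_diff_left lie_diff_right derivation_closed D E lie_closed)
  finally show "(D \<otimes>\<^bsub>Der\<^esub> E) (u \<otimes> v) = (D \<otimes>\<^bsub>Der\<^esub> E) u \<otimes> v \<oplus> u \<otimes> (D \<otimes>\<^bsub>Der\<^esub> E) v"
    using u v by (simp add: mult_Der)
qed

lemma lie_ring_Der: "lie_ring Der"
proof (intro lie_ring.intro lie_ring_axioms.intro abelian_groupI; unfold carrier_Der)
  fix D E F assume D: "D \<in> derivations L" and E: "E \<in> derivations L" and F: "F \<in> derivations L"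
  note closed = D E F derivation_closed add_derivation mult_derivation zero_derivation
  show "(D \<oplus>\<^bsub>Der\<^esub> E) \<oplus>\<^bsub>Der\<^esub> F = D \<oplus>\<^bsub>Der\<^esub> (E \<oplus>\<^bsub>Der\<^esub> F)"
    by (rule derivation_eqI) (simp_all add: closed add_Der a_assoc)
  show "(D \<oplus>\<^bsub>Der\<^esub> E) \<otimes>\<^bsub>Der\<^esub> F = (D \<otimes>\<^bsub>Der\<^esub> F) \<oplus>\<^bsub>Der\<^esub> (E \<otimes>\<^bsub>Der\<^esub> F)"
    by (rule derivation_eqI) (simp_all add: closed add_Der mult_Der derivation_add add_minus_add)
  show "D \<otimes>\<^bsub>Der\<^esub> (E \<oplus>\<^bsub>Der\<^esub> F) = (D \<otimes>\<^bsub>Der\<^esub> E) \<oplus>\<^bsub>Der\<^esub> (D \<otimes>\<^bsub>Der\<^esub> F)"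
    by (rule derivation_eqI) (simp_all add: closed add_Der mult_Der derivation_add add_minus_add)
  show "((D \<otimes>\<^bsub>Der\<^esub> E) \<otimes>\<^bsub>Der\<^esub> F) \<oplus>\<^bsub>Der\<^esub> ((E \<otimes>\<^bsub>Der\<^esub> F) \<otimes>\<^bsub>Der\<^esub> D)
      \<oplus>\<^bsub>Der\<^esub> ((F \<otimes>\<^bsub>Der\<^esub> D) \<otimes>\<^bsub>Der\<^esub> E) = \<zero>\<^bsub>Der\<^esub>"
  proof (rule derivation_eqI)
    fix u assume u: "u \<in> carrier L"
    (* Each of the six orders of composition occurs once with each sign. *)
    have "(((D \<otimes>\<^bsub>Der\<^esub> E) \<otimes>\<^bsub>Der\<^esub> F) \<oplus>\<^bsub>Der\<^esub> ((E \<otimes>\<^bsub>Der\<^esub> F) \<otimes>\<^bsub>Der\<^esub> D)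
      \<oplus>\<^bsub>Der\<^esub> ((F \<otimes>\<^bsub>Der\<^esub> D) \<otimes>\<^bsub>Der\<^esub> E)) u =
        ((F (E (D u)) \<oplus> D (E (F u))) \<ominus> (F (D (E u)) \<oplus> E (D (F u))))
      \<oplus> ((D (F (E u)) \<oplus> E (F (D u))) \<ominus> (D (E (F u)) \<oplus> F (E (D u))))
      \<oplus> ((E (D (F u)) \<oplus> F (D (E u))) \<ominus> (E (F (D u)) \<oplus> D (F (E u))))"
      using u by (simp add: closed add_Der mult_Der derivation_diff minus_minus_minus)
    also have "\<dots> =
        ((F (E (D u)) \<oplus> D (E (F u))) \<oplus> (D (F (E u)) \<oplus> E (F (D u))) \<oplus> (E (D (F u)) \<oplus> F (D (E u))))
      \<ominus> ((F (D (E u)) \<oplus> E (D (F u))) \<oplus> (D (E (F u)) \<oplus> F (E (D u))) \<oplus> (E (F (D u)) \<oplus> D (F (E u))))"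
      using u by (simp add: closed flip: add_minus_add)
    also have "\<dots> =
        ((F (E (D u)) \<oplus> D (E (F u))) \<oplus> (D (F (E u)) \<oplus> E (F (D u))) \<oplus> (E (D (F u)) \<oplus> F (D (E u))))
      \<ominus> ((F (E (D u)) \<oplus> D (E (F u))) \<oplus> (D (F (E u)) \<oplus> E (F (D u))) \<oplus> (E (D (F u)) \<oplus> F (D (E u))))"
      using u by (simp add: closed a_ac)
    also have "\<dots> = \<zero>"
      using u by (simp add: closed minus_self)
    finally show "(((D \<otimes>\<^bsub>Der\<^esub> E) \<otimes>\<^bsub>Der\<^esub> F) \<oplus>\<^bsub>Der\<^esub> ((E \<otimes>\<^bsub>Der\<^esub> F) \<otimes>\<^bsub>Der\<^esub> D)
      \<oplus>\<^bsub>Der\<^esub> ((F \<otimes>\<^bsub>Der\<^esub> D) \<otimes>\<^bsub>Der\<^esub> E)) u = \<zero>\<^bsub>Der\<^esub> u"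
      using u by (simp add: zero_Der)
  qed (simp_all add: closed zero_Der)
next
  fix D E assume D: "D \<in> derivations L" and E: "E \<in> derivations L"
  note closed = D E derivation_closed add_derivation mult_derivation zero_derivation
  show "D \<oplus>\<^bsub>Der\<^esub> E \<in> derivations L" "D \<otimes>\<^bsub>Der\<^esub> E \<in> derivations L"
    by (simp_all add: closed)
  show "D \<oplus>\<^bsub>Der\<^esub> E = E \<oplus>\<^bsub>Der\<^esub> D"
    by (rule derivation_eqI) (simp_all add: closed add_Der a_comm)
next
  fix D assume D: "D \<in> derivations L"
  show "\<zero>\<^bsub>Der\<^esub> \<oplus>\<^bsub>Der\<^esub> D = D"
    using D zero_derivation
    by (intro derivation_eqI) (simp_all add: zero_Der add_derivation add_Der derivation_closed)
  show "D \<otimes>\<^bsub>Der\<^esub> D = \<zero>\<^bsub>Der\<^esub>"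
    using D zero_derivation
    by (intro derivation_eqI) (simp_all add: zero_Der mult_derivation mult_Der derivation_closed minus_self)
  show "\<exists>E\<in>derivations L. E \<oplus>\<^bsub>Der\<^esub> D = \<zero>\<^bsub>Der\<^esub>"
    using D zero_derivation minus_derivation[OF D]
    by (intro bexI[OF _ minus_derivation[OF D]] derivation_eqI)
      (simp_all add: zero_Der add_derivation add_Der derivation_closed l_neg)
next
  show "\<zero>\<^bsub>Der\<^esub> \<in> derivations L"
    by (simp add: zero_Der zero_derivation)
qed

end

section \<open>The filtration of an acting group\<close>

locale automorphism_action = G: group G + A: group A
  for G :: "('a, 'm) monoid_scheme" and A :: "('b, 'n) monoid_scheme" +
  fixes \<phi> :: "'b \<Rightarrow> 'a \<Rightarrow> 'a"
  assumes action_hom: "\<phi> \<in> hom A (opposite_group (AutoGroup G))"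

sublocale automorphism_action \<subseteq> LG: strongly_central_series G "lower_central G"
  by (rule G.strongly_central_series_lower_central)

context automorphism_action
begin

abbreviation \<gamma> :: "nat \<Rightarrow> 'a set" where
  "\<gamma> \<equiv> lower_central G"

abbreviation filtration :: "nat \<Rightarrow> 'b set" where
  "filtration \<equiv> action_series A G \<phi>"

text \<open>The commutator \<open>[g, a]\<close> in the semidirect product of \<open>G\<close> and \<open>A\<close>.\<close>

abbreviation displacement :: "'b \<Rightarrow> 'a \<Rightarrow> 'a" where
  "displacement a g \<equiv> inv\<^bsub>G\<^esub> g \<otimes>\<^bsub>G\<^esub> \<phi> a g"

lemma action_auto: "a \<in> carrier A \<Longrightarrow> \<phi> a \<in> auto G"
  using action_hom by (auto simp: hom_def opposite_group_def AutoGroup_def)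

lemma action_group_hom: "a \<in> carrier A \<Longrightarrow> group_hom G G (\<phi> a)"
  using action_auto[of a] by unfold_locales (simp add: auto_def)

lemma action_closed [simp]: "\<lbrakk>a \<in> carrier A; g \<in> carrier G\<rbrakk> \<Longrightarrow> \<phi> a g \<in> carrier G"
  using action_group_hom group_hom.hom_closed by metis

lemma action_mult [simp]:
  "\<lbrakk>a \<in> carrier A; g \<in> carrier G; h \<in> carrier G\<rbrakk> \<Longrightarrow> \<phi> a (g \<otimes>\<^bsub>G\<^esub> h) = \<phi> a g \<otimes>\<^bsub>G\<^esub> \<phi> a h"
  using action_group_hom group_hom.hom_mult by metis

lemma action_inv [simp]:
  "\<lbrakk>a \<in> carrier A; g \<in> carrier G\<rbrakk> \<Longrightarrow> \<phi> a (inv\<^bsub>G\<^esub> g) = inv\<^bsub>G\<^esub> \<phi> a g"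
  using action_group_hom group_hom.hom_inv by metis

lemma action_inj: "a \<in> carrier A \<Longrightarrow> inj_on (\<phi> a) (carrier G)"
  using action_auto[of a] by (auto simp: auto_def Bij_def bij_betw_def)

lemma action_comp:
  assumes "a \<in> carrier A" "b \<in> carrier A" "g \<in> carrier G"
  shows "\<phi> (a \<otimes>\<^bsub>A\<^esub> b) g = \<phi> b (\<phi> a g)"
  using hom_mult[OF action_hom assms(1,2)] action_auto[OF assms(1)] action_auto[OF assms(2)] assms(3)
  by (simp add: opposite_group_def AutoGroup_def BijGroup_def auto_def compose_def)

lemma action_one [simp]:
  assumes "g \<in> carrier G" shows "\<phi> \<one>\<^bsub>A\<^esub> g = g"
proof (rule inj_onD[OF action_inj])
  show "\<phi> \<one>\<^bsub>A\<^esub> (\<phi> \<one>\<^bsub>A\<^esub> g) = \<phi> \<one>\<^bsub>A\<^esub> g"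
    using action_comp[of "\<one>\<^bsub>A\<^esub>" "\<one>\<^bsub>A\<^esub>" g] assms by simp
qed (use assms in auto)

lemma action_inv_cancel [simp]:
  assumes "a \<in> carrier A" "g \<in> carrier G"
  shows "\<phi> a (\<phi> (inv\<^bsub>A\<^esub> a) g) = g" "\<phi> (inv\<^bsub>A\<^esub> a) (\<phi> a g) = g"
  using assms action_comp[of "inv\<^bsub>A\<^esub> a" a g] action_comp[of a "inv\<^bsub>A\<^esub> a" g] by simp_all

lemma action_lower_central: "\<lbrakk>a \<in> carrier A; g \<in> \<gamma> j\<rbrakk> \<Longrightarrow> \<phi> a g \<in> \<gamma> j"
  using G.lower_central_hom action_auto by (auto simp: auto_def)

lemma action_eq_displacement:
  "\<lbrakk>a \<in> carrier A; g \<in> carrier G\<rbrakk> \<Longrightarrow> \<phi> a g = g \<otimes>\<^bsub>G\<^esub> displacement a g"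
  by (simp add: G.word_simps)

lemma displacement_closed:
  "\<lbrakk>a \<in> carrier A; g \<in> carrier G\<rbrakk> \<Longrightarrow> displacement a g \<in> carrier G"
  by simp

lemma displacement_comp:
  assumes "a \<in> carrier A" "b \<in> carrier A" "g \<in> carrier G"
  shows "displacement (a \<otimes>\<^bsub>A\<^esub> b) g = displacement b g \<otimes>\<^bsub>G\<^esub> \<phi> b (displacement a g)"
  using assms by (simp add: action_comp G.word_simps)

text \<open>The conjugation by \<open>h\<close> is invisible in the factors, so displacement is additive there.\<close>

lemma displacement_mult:
  assumes "a \<in> carrier A" "g \<in> carrier G" "h \<in> carrier G"
  shows "displacement a (g \<otimes>\<^bsub>G\<^esub> h)
    = (inv\<^bsub>G\<^esub> h \<otimes>\<^bsub>G\<^esub> displacement a g \<otimes>\<^bsub>G\<^esub> h) \<otimes>\<^bsub>G\<^esub> displacement a h"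
  using assms by (simp add: G.word_simps)

text \<open>From \<open>a b = b a [a, b]\<close>: the element \<open>[a, b]\<close> moves \<open>g\<^sup>b\<^sup>a\<close> to \<open>g\<^sup>a\<^sup>b\<close>, and both are expanded
  through \<open>g\<^sup>a = g d\<^sub>a(g)\<close>. This explains why the displacement is taken at \<open>g\<^sup>b\<^sup>a\<close> and not at
  \<open>g\<close>.\<close>

lemma displacement_commutator:
  assumes "a \<in> carrier A" "b \<in> carrier A" "g \<in> carrier G"
  shows "displacement (commutator A a b) (\<phi> (b \<otimes>\<^bsub>A\<^esub> a) g)
    = inv\<^bsub>G\<^esub> displacement a (displacement b g)
      \<otimes>\<^bsub>G\<^esub> commutator G (displacement b g) (displacement a g)
      \<otimes>\<^bsub>G\<^esub> displacement b (displacement a g)"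
proof -
  have "\<phi> (commutator A a b) (\<phi> (b \<otimes>\<^bsub>A\<^esub> a) g) = \<phi> (a \<otimes>\<^bsub>A\<^esub> b) g"
    using assms A.mult_commute_commutator[of a b] by (simp flip: action_comp)
  then show ?thesis
    using assms by (simp add: action_comp commutator_def G.word_simps)
qed

lemma filtrationD:
  assumes "a \<in> filtration i"
  shows "a \<in> carrier A" and "\<lbrakk>0 < j; g \<in> \<gamma> j\<rbrakk> \<Longrightarrow> displacement a g \<in> \<gamma> (i + j)"
  using assms by (auto simp: action_series_def)

lemma filtration_subgroup:
  assumes "0 < i" shows "subgroup (filtration i) A"
proof (rule A.subgroupI)
  show "filtration i \<subseteq> carrier A"
    by (auto simp: action_series_def)
  have "displacement \<one>\<^bsub>A\<^esub> g \<in> \<gamma> (i + j)" if "0 < j" "g \<in> \<gamma> j" for j g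
    using that LG.series_carrier[of g j] LG.series_one[of "i + j"] by simp
  then show "filtration i \<noteq> {}"
    by (auto simp: action_series_def)
next
  fix a assume a: "a \<in> filtration i"
  have "displacement (inv\<^bsub>A\<^esub> a) g \<in> \<gamma> (i + j)" if j: "0 < j" and g: "g \<in> \<gamma> j" for j g
  proof -
    have gc: "g \<in> carrier G" "a \<in> carrier A"
      using g j a filtrationD LG.series_carrier by auto
    have "displacement a (\<phi> (inv\<^bsub>A\<^esub> a) g) \<in> \<gamma> (i + j)"
      using a j g filtrationD action_lower_central by simp
    then have "inv\<^bsub>G\<^esub> displacement a (\<phi> (inv\<^bsub>A\<^esub> a) g) \<in> \<gamma> (i + j)"
      using j LG.series_inv by simp
    then show ?thesis
      using gc by (simp add: G.word_simps)
  qed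
  then show "inv\<^bsub>A\<^esub> a \<in> filtration i"
    using a by (auto simp: action_series_def)
next
  fix a b assume a: "a \<in> filtration i" and b: "b \<in> filtration i"
  have "displacement (a \<otimes>\<^bsub>A\<^esub> b) g \<in> \<gamma> (i + j)" if j: "0 < j" and g: "g \<in> \<gamma> j" for j g
  proof -
    have "displacement b g \<in> \<gamma> (i + j)" "\<phi> b (displacement a g) \<in> \<gamma> (i + j)"
      using filtrationD[OF a] filtrationD[OF b] action_lower_central j g by blast+
    then show ?thesis
      using displacement_comp[of a b g] filtrationD(1)[OF a] filtrationD(1)[OF b]
        LG.series_carrier[OF g j] LG.series_mult[of "i + j"] j by simp
  qed
  then show "a \<otimes>\<^bsub>A\<^esub> b \<in> filtration i"
    using a b by (auto simp: action_series_def)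
qed

text \<open>The displacement of \<open>g\<close> by \<open>b a b\<inverse>\<close> is the image under \<open>b\<inverse>\<close> of the displacement of \<open>g\<^sup>b\<close>
  by \<open>a\<close>, and the lower central series is invariant under automorphisms.\<close>

lemma filtration_normal:
  assumes "0 < i" shows "filtration i \<lhd> A"
proof -
  have "b \<otimes>\<^bsub>A\<^esub> a \<otimes>\<^bsub>A\<^esub> inv\<^bsub>A\<^esub> b \<in> filtration i" if a: "a \<in> filtration i" and b: "b \<in> carrier A" for a b
  proof -
    have "displacement (b \<otimes>\<^bsub>A\<^esub> a \<otimes>\<^bsub>A\<^esub> inv\<^bsub>A\<^esub> b) g \<in> \<gamma> (i + j)" if j: "0 < j" and g: "g \<in> \<gamma> j" for j g
    proof -
      have gc: "g \<in> carrier G"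
        using LG.series_carrier[OF g j] .
      have "\<phi> (inv\<^bsub>A\<^esub> b) (displacement a (\<phi> b g)) \<in> \<gamma> (i + j)"
        using filtrationD(2)[OF a j] action_lower_central b g by simp
      then show ?thesis
        using filtrationD(1)[OF a] b gc by (simp add: action_comp)
    qed
    then show ?thesis
      using filtrationD(1)[OF a] b by (auto simp: action_series_def)
  qed
  then show ?thesis
    using filtration_subgroup[OF assms] by (auto simp: A.normal_inv_iff)
qed

lemma filtration_Suc_subset:
  assumes "0 < i" shows "filtration (Suc i) \<subseteq> filtration i"
proof -
  have "\<gamma> (Suc i + j) \<subseteq> \<gamma> (i + j)" for j
    using G.lower_central_Suc_subset by simp
  then show ?thesis
    unfolding action_series_def by blast
qed

text \<open>Every \<open>g \<in> \<gamma> k\<close> has the form \<open>h\<^sup>b\<^sup>a\<close> with \<open>h \<in> \<gamma> k\<close>. All three factors in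
  \<open>displacement_commutator\<close> then lie in \<open>\<gamma> (i + j + k)\<close>.\<close>

lemma filtration_commutator:
  assumes "0 < i" "0 < j" and a: "a \<in> filtration i" and b: "b \<in> filtration j"
  shows "commutator A a b \<in> filtration (i + j)"
proof -
  have ac: "a \<in> carrier A" and bc: "b \<in> carrier A"
    using a b filtrationD by auto
  have "displacement (commutator A a b) g \<in> \<gamma> (i + j + k)" if k: "0 < k" and g: "g \<in> \<gamma> k" for k g
  proof -
    define h where "h = \<phi> (inv\<^bsub>A\<^esub> (b \<otimes>\<^bsub>A\<^esub> a)) g"
    have h: "h \<in> \<gamma> k" "h \<in> carrier G" and gh: "g = \<phi> (b \<otimes>\<^bsub>A\<^esub> a) h"
      using ac bc g k LG.series_carrier[OF g k] action_lower_central
      by (simp_all add: h_def del: A.inv_mult_group)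
    have da: "displacement a h \<in> \<gamma> (i + k)" and db: "displacement b h \<in> \<gamma> (j + k)"
      using filtrationD(2)[OF a k] filtrationD(2)[OF b k] h by auto
    have pos: "0 < i + j + k"
      using k by simp
    have dab: "displacement a (displacement b h) \<in> \<gamma> (i + j + k)"
      and dba: "displacement b (displacement a h) \<in> \<gamma> (i + j + k)"
      using filtrationD(2)[OF a _ db] filtrationD(2)[OF b _ da] k by (simp_all add: ac_simps)
    have com: "commutator G (displacement b h) (displacement a h) \<in> \<gamma> (i + j + k)"
      using k by (intro LG.series_commutator_le[OF db da]) auto
    show ?thesis
      unfolding gh displacement_commutator[OF ac bc h(2)]
      by (rule LG.series_mult[OF pos LG.series_mult[OF pos LG.series_inv[OF pos dab] com] dba])
  qed
  then show ?thesis
    using ac bc by (simp add: action_series_def)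
qed

end

sublocale automorphism_action \<subseteq> LA: strongly_central_series A "action_series A G \<phi>"
  by (intro strongly_central_series.intro strongly_central_series_axioms.intro A.is_group
      filtration_normal filtration_Suc_subset filtration_commutator)

section \<open>The derivations induced by the filtration\<close>

context automorphism_action
begin

lemma derivation_eq_classI:
  assumes D: "D \<in> derivations LG.L" and E: "E \<in> derivations LG.L"
    and eq: "\<And>j g. \<lbrakk>0 < j; g \<in> \<gamma> j\<rbrakk> \<Longrightarrow> D (LG.cls j g) = E (LG.cls j g)"
  shows "D = E"
proof (rule LG.L.derivation_eqI[OF D E])
  fix u assume "u \<in> carrier LG.L"
  then show "D u = E u"
    by (induction u rule: LG.L_induct) (simp_all add: eq LG.L.derivation_add D E)
qed

text \<open>The Leibniz rule on classes. With \<open>p = d\<^sub>a(x)\<close> and \<open>q = d\<^sub>a(y)\<close>, the automorphism \<open>a\<close> sends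
  \<open>[x, y]\<close> to \<open>[x p, y q]\<close>. When this is expanded and \<open>[x, y]\<close> is split off, only \<open>[x, q]\<close> and
  \<open>[p, y]\<close> survive: the weights in every other factor add up to more than
  \<open>i + j + k\<close>.\<close>

lemma displacement_commutator_class:
  assumes i: "0 < i" and a: "a \<in> filtration i"
    and jk: "0 < j" "0 < k" and x: "x \<in> \<gamma> j" and y: "y \<in> \<gamma> k"
  shows "LG.cls (i + (j + k)) (displacement a (commutator G x y))
    = LG.cls (i + j) (displacement a x) \<otimes>\<^bsub>LG.L\<^esub> LG.cls k y
      \<oplus>\<^bsub>LG.L\<^esub> LG.cls j x \<otimes>\<^bsub>LG.L\<^esub> LG.cls (i + k) (displacement a y)"
proof -
  define n where "n = i + (j + k)"
  define p where "p = displacement a x"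
  define q where "q = displacement a y"
  have n: "0 < n"
    using i by (simp add: n_def)
  have ac: "a \<in> carrier A"
    using filtrationD(1)[OF a] .
  have xc: "x \<in> carrier G" and yc: "y \<in> carrier G"
    using LG.series_carrier x y jk by auto
  have p: "p \<in> \<gamma> (i + j)" and q: "q \<in> \<gamma> (i + k)"
    using filtrationD(2)[OF a] x y jk by (auto simp: p_def q_def)
  have pc: "p \<in> carrier G" and qc: "q \<in> carrier G"
    using p q i LG.series_carrier by auto
  have xy: "commutator G x y \<in> \<gamma> (j + k)"
    using LG.series_commutator jk x y by auto
  have xq: "commutator G x q \<in> \<gamma> n"
    using LG.series_commutator_le[OF x q] jk i by (simp add: n_def)
  have py: "commutator G p y \<in> \<gamma> n"
    using LG.series_commutator_le[OF p y] jk i by (simp add: n_def)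
  have xyq: "y \<otimes>\<^bsub>G\<^esub> q \<in> \<gamma> k"
    using y q jk LG.series_mem_mono[OF q, of k] LG.series_mult by simp
  have t1: "commutator G (commutator G x y) q \<in> \<gamma> (Suc n)"
    using jk i by (intro LG.series_commutator_le[OF xy q]) (auto simp: n_def)
  have t2: "commutator G (commutator G x (y \<otimes>\<^bsub>G\<^esub> q)) p \<in> \<gamma> (Suc n)"
    using jk i by (intro LG.series_commutator_le[OF LG.series_commutator[OF jk x xyq] p]) (auto simp: n_def)
  have t3: "commutator G p q \<in> \<gamma> (Suc n)"
    using jk i by (intro LG.series_commutator_le[OF p q]) (auto simp: n_def)
  have t4: "commutator G (commutator G p y) q \<in> \<gamma> (Suc n)"
    using jk i n by (intro LG.series_commutator_le[OF py q]) (auto simp: n_def)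
  have t: "t \<in> \<gamma> n" "LG.cls n t = \<zero>\<^bsub>LG.L\<^esub>" if "t \<in> \<gamma> (Suc n)" for t
    using that n LG.series_mem_mono[OF that, of n] by (auto simp: LG.cls_eq_zero_iff)
  have "\<phi> a (commutator G x y) = commutator G (x \<otimes>\<^bsub>G\<^esub> p) (y \<otimes>\<^bsub>G\<^esub> q)"
    using ac xc yc by (simp add: p_def q_def commutator_def G.word_simps)
  then have "displacement a (commutator G x y)
      = (inv\<^bsub>G\<^esub> (commutator G x y) \<otimes>\<^bsub>G\<^esub> commutator G x q \<otimes>\<^bsub>G\<^esub> commutator G x y)
        \<otimes>\<^bsub>G\<^esub> (commutator G (commutator G x y) q \<otimes>\<^bsub>G\<^esub> commutator G (commutator G x (y \<otimes>\<^bsub>G\<^esub> q)) p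
        \<otimes>\<^bsub>G\<^esub> (commutator G p q \<otimes>\<^bsub>G\<^esub> (commutator G p y \<otimes>\<^bsub>G\<^esub> commutator G (commutator G p y) q)))"
    using xc yc pc qc by (simp add: commutator_def G.word_simps)
  moreover have "inv\<^bsub>G\<^esub> (commutator G x y) \<otimes>\<^bsub>G\<^esub> commutator G x q \<otimes>\<^bsub>G\<^esub> commutator G x y \<in> \<gamma> n"
    using n xq xc yc by (intro LG.series_conj) auto
  moreover have "LG.cls n (inv\<^bsub>G\<^esub> (commutator G x y) \<otimes>\<^bsub>G\<^esub> commutator G x q \<otimes>\<^bsub>G\<^esub> commutator G x y)
      = LG.cls n (commutator G x q)"
    using n xq xc yc by (intro LG.cls_conj) auto
  ultimately have "LG.cls n (displacement a (commutator G x y))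
      = LG.cls n (commutator G x q) \<oplus>\<^bsub>LG.L\<^esub> LG.cls n (commutator G p y)"
    using n t[OF t1] t[OF t2] t[OF t3] t[OF t4] xq py
    by (simp add: LG.cls_mult LG.series_mult LG.cls_closed)
  also have "\<dots> = LG.cls n (commutator G p y) \<oplus>\<^bsub>LG.L\<^esub> LG.cls n (commutator G x q)"
    using n xq py by (intro LG.L.a_comm) auto
  finally show ?thesis
    using p q x y jk i
    by (simp add: LG.mult_L_cls flip: p_def q_def) (simp add: n_def ac_simps)
qed

lemma ex1_derivation:
  assumes i: "0 < i" and a: "a \<in> filtration i"
  shows "\<exists>!D. D \<in> derivations LG.L \<and>
    (\<forall>j>0. \<forall>g\<in>\<gamma> j. D (LG.cls j g) = LG.cls (i + j) (displacement a g))"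
proof (rule ex_ex1I)
  have ac: "a \<in> carrier A"
    using filtrationD(1)[OF a] .
  have "LG.cls (i + j) (displacement a (g \<otimes>\<^bsub>G\<^esub> h))
      = LG.cls (i + j) (displacement a g) \<oplus>\<^bsub>LG.L\<^esub> LG.cls (i + j) (displacement a h)"
    if j: "0 < j" and g: "g \<in> \<gamma> j" and h: "h \<in> \<gamma> j" for j g h
  proof -
    have c: "g \<in> carrier G" "h \<in> carrier G"
      using LG.series_carrier j g h by auto
    have d: "displacement a g \<in> \<gamma> (i + j)" "displacement a h \<in> \<gamma> (i + j)"
      using filtrationD(2)[OF a j] g h by auto
    have "inv\<^bsub>G\<^esub> h \<otimes>\<^bsub>G\<^esub> displacement a g \<otimes>\<^bsub>G\<^esub> h \<in> \<gamma> (i + j)"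
      using LG.series_conj[OF _ d(1) c(2)] i by simp
    then show ?thesis
      unfolding displacement_mult[OF ac c]
      using LG.cls_conj[OF _ d(1), of h] d i c by (simp only: LG.cls_mult) simp
  qed
  moreover have "LG.cls (i + j) (displacement a g) = \<zero>\<^bsub>LG.L\<^esub>" if "0 < j" "g \<in> \<gamma> (Suc j)" for j g
    using filtrationD(2)[OF a, of "Suc j" g] that i LG.series_mem_mono[of _ "Suc (i + j)" "i + j"]
    by (simp add: LG.cls_eq_zero_iff)
  moreover have "LG.cls (i + j) (displacement a g) \<in> carrier LG.L" if "0 < j" "g \<in> \<gamma> j" for j g
    using filtrationD(2)[OF a that] i by auto
  ultimately obtain D where ext: "D \<in> extensional (carrier LG.L)"
    and hom: "D \<in> hom (add_monoid LG.L) (add_monoid LG.L)"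
    and D: "\<And>j g. \<lbrakk>0 < j; g \<in> \<gamma> j\<rbrakk> \<Longrightarrow> D (LG.cls j g) = LG.cls (i + j) (displacement a g)"
    using LG.additive_extension[OF LG.abelian_group_L,
        of "\<lambda>j g. LG.cls (i + j) (displacement a g)"] by blast
  have closed: "D u \<in> carrier LG.L" if "u \<in> carrier LG.L" for u
    using hom that by (auto simp: hom_def)
  have add: "D (u \<oplus>\<^bsub>LG.L\<^esub> v) = D u \<oplus>\<^bsub>LG.L\<^esub> D v" if "u \<in> carrier LG.L" "v \<in> carrier LG.L" for u v
    using hom that by (auto simp: hom_def)
  note L_simps = closed add LG.L.lie_closed LG.L.lie_add_left LG.L.lie_add_right LG.L.a_ac
  have leibniz_cls: "D (LG.cls j x \<otimes>\<^bsub>LG.L\<^esub> v) = D (LG.cls j x) \<otimes>\<^bsub>LG.L\<^esub> v \<oplus>\<^bsub>LG.L\<^esub> LG.cls j x \<otimes>\<^bsub>LG.L\<^esub> D v"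
    if jx: "0 < j" "x \<in> \<gamma> j" and v: "v \<in> carrier LG.L" for j x v
    using v
  proof (induction v rule: LG.L_induct)
    case (cls k y)
    then show ?case
      using jx displacement_commutator_class[OF i a] LG.series_commutator
      by (simp add: LG.mult_L_cls D)
  next
    case (add v w)
    then show ?case
      using jx by (simp add: L_simps LG.cls_closed)
  qed
  have leibniz: "D (u \<otimes>\<^bsub>LG.L\<^esub> v) = D u \<otimes>\<^bsub>LG.L\<^esub> v \<oplus>\<^bsub>LG.L\<^esub> u \<otimes>\<^bsub>LG.L\<^esub> D v"
    if u: "u \<in> carrier LG.L" and v: "v \<in> carrier LG.L" for u v
    using u
  proof (induction u rule: LG.L_induct)
    case (add u w)
    then show ?case
      using v by (simp add: L_simps)
  qed (rule leibniz_cls[OF _ _ v])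
  have "D \<in> derivations LG.L"
    using ext closed add leibniz by (rule LG.L.derivationI)
  then show "\<exists>D. D \<in> derivations LG.L \<and>
      (\<forall>j>0. \<forall>g\<in>\<gamma> j. D (LG.cls j g) = LG.cls (i + j) (displacement a g))"
    using D by blast
qed (auto intro: derivation_eq_classI)

definition action_derivation :: "nat \<Rightarrow> 'b \<Rightarrow> (nat \<Rightarrow> 'a set) \<Rightarrow> nat \<Rightarrow> 'a set" where
  "action_derivation i a = (THE D. D \<in> derivations LG.L \<and>
    (\<forall>j>0. \<forall>g\<in>\<gamma> j. D (LG.cls j g) = LG.cls (i + j) (displacement a g)))"

lemma action_derivation:
  assumes "0 < i" "a \<in> filtration i"
  shows "action_derivation i a \<in> derivations LG.L"
    and "\<lbrakk>0 < j; g \<in> \<gamma> j\<rbrakk> \<Longrightarrow> action_derivation i a (LG.cls j g) = LG.cls (i + j) (displacement a g)"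
  using theI'[OF ex1_derivation[OF assms]] unfolding action_derivation_def by blast+

text \<open>Here \<open>d\<^bsub>ab\<^esub>(g) = d\<^sub>b(g) d\<^sub>a(g) d\<^sub>b(d\<^sub>a(g))\<close>, and the last factor lies deeper.\<close>

lemma action_derivation_mult:
  assumes i: "0 < i" and a: "a \<in> filtration i" and b: "b \<in> filtration i"
  shows "action_derivation i (a \<otimes>\<^bsub>A\<^esub> b)
    = action_derivation i a \<oplus>\<^bsub>der_lie_ring LG.L\<^esub> action_derivation i b"
proof (rule derivation_eq_classI)
  have ab: "a \<otimes>\<^bsub>A\<^esub> b \<in> filtration i"
    using LA.series_mult i a b by blast
  show "action_derivation i (a \<otimes>\<^bsub>A\<^esub> b) \<in> derivations LG.L"
    by (rule action_derivation[OF i ab])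
  show "action_derivation i a \<oplus>\<^bsub>der_lie_ring LG.L\<^esub> action_derivation i b \<in> derivations LG.L"
    by (intro LG.L.add_derivation action_derivation i a b)
  fix j :: nat and g assume j: "0 < j" and g: "g \<in> \<gamma> j"
  have c: "a \<in> carrier A" "b \<in> carrier A" "g \<in> carrier G"
    using filtrationD(1) a b LG.series_carrier[OF g j] by auto
  let ?p = "displacement a g" and ?q = "displacement b g"
  have pq: "?p \<in> \<gamma> (i + j)" "?q \<in> \<gamma> (i + j)"
    using filtrationD(2) a b j g by auto
  have "displacement b ?p \<in> \<gamma> (i + (i + j))"
    using filtrationD(2)[OF b _ pq(1)] j by simp
  then have r: "displacement b ?p \<in> \<gamma> (Suc (i + j))"
    using i by (rule_tac LG.series_mem_mono) auto
  then have r': "displacement b ?p \<in> \<gamma> (i + j)"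
    using j by (rule_tac LG.series_mem_mono) auto
  have "displacement (a \<otimes>\<^bsub>A\<^esub> b) g = ?q \<otimes>\<^bsub>G\<^esub> (?p \<otimes>\<^bsub>G\<^esub> displacement b ?p)"
    using c displacement_comp[of a b g] action_eq_displacement[of b ?p] by (simp only: displacement_closed)
  then have "LG.cls (i + j) (displacement (a \<otimes>\<^bsub>A\<^esub> b) g)
      = LG.cls (i + j) ?q \<oplus>\<^bsub>LG.L\<^esub> (LG.cls (i + j) ?p \<oplus>\<^bsub>LG.L\<^esub> LG.cls (i + j) (displacement b ?p))"
    using i pq r' by (simp only: LG.cls_mult LG.series_mult add_pos_pos j)
  also have "\<dots> = LG.cls (i + j) ?p \<oplus>\<^bsub>LG.L\<^esub> LG.cls (i + j) ?q"
    using i pq r' iffD2[OF LG.cls_eq_zero_iff[OF _ r'] r]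
    by (simp only: LG.cls_closed LG.L.r_zero LG.L.a_comm add_pos_pos j)
  finally show "action_derivation i (a \<otimes>\<^bsub>A\<^esub> b) (LG.cls j g)
      = (action_derivation i a \<oplus>\<^bsub>der_lie_ring LG.L\<^esub> action_derivation i b) (LG.cls j g)"
    using i a b ab j g by (simp only: LG.L.add_Der LG.cls_closed action_derivation(2))
qed

lemma action_derivation_zero:
  assumes i: "0 < i" and a: "a \<in> filtration (Suc i)"
  shows "action_derivation i a = \<zero>\<^bsub>der_lie_ring LG.L\<^esub>"
proof (rule derivation_eq_classI)
  have a': "a \<in> filtration i"
    using a i LA.series_Suc_subset by blast
  show "action_derivation i a \<in> derivations LG.L"
    by (rule action_derivation[OF i a'])
  show "\<zero>\<^bsub>der_lie_ring LG.L\<^esub> \<in> derivations LG.L"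
    by (simp add: LG.L.zero_Der LG.L.zero_derivation)
  fix j :: nat and g assume j: "0 < j" and g: "g \<in> \<gamma> j"
  have "displacement a g \<in> \<gamma> (i + j)" "displacement a g \<in> \<gamma> (Suc (i + j))"
    using filtrationD(2)[OF a' j g] filtrationD(2)[OF a j g] by auto
  then have "LG.cls (i + j) (displacement a g) = \<zero>\<^bsub>LG.L\<^esub>"
    using i by (simp only: LG.cls_eq_zero_iff add_pos_pos j)
  then show "action_derivation i a (LG.cls j g) = \<zero>\<^bsub>der_lie_ring LG.L\<^esub> (LG.cls j g)"
    using i a' j g by (simp only: action_derivation(2) LG.L.zero_Der LG.cls_closed restrict_apply' )
qed

text \<open>The middle factor of \<open>displacement_commutator\<close> lies deeper and the outer ones give
  \<open>D\<^sub>a D\<^sub>b - D\<^sub>b D\<^sub>a\<close>. The formula concerns \<open>g\<^sup>b\<^sup>a\<close>, but that element has the same class as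
  \<open>g\<close>.\<close>

lemma action_derivation_commutator:
  assumes ij: "0 < i" "0 < j" and a: "a \<in> filtration i" and b: "b \<in> filtration j"
  shows "action_derivation (i + j) (commutator A a b)
    = action_derivation i a \<otimes>\<^bsub>der_lie_ring LG.L\<^esub> action_derivation j b"
proof (rule derivation_eq_classI)
  have c: "commutator A a b \<in> filtration (i + j)" "0 < i + j"
    using LA.series_commutator ij a b by auto
  show "action_derivation (i + j) (commutator A a b) \<in> derivations LG.L"
    by (rule action_derivation[OF c(2,1)])
  show "action_derivation i a \<otimes>\<^bsub>der_lie_ring LG.L\<^esub> action_derivation j b \<in> derivations LG.L"
    by (intro LG.L.mult_derivation action_derivation ij a b)
  fix k :: nat and g assume k: "0 < k" and g: "g \<in> \<gamma> k"
  define n where "n = i + j + k"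
  have n: "0 < n"
    using k by (simp add: n_def)
  have ab: "a \<in> carrier A" "b \<in> carrier A" "g \<in> carrier G"
    using filtrationD(1) a b LG.series_carrier[OF g k] by auto
  let ?h = "\<phi> (b \<otimes>\<^bsub>A\<^esub> a) g"
  let ?p = "displacement a g" and ?q = "displacement b g"
  have pq: "?p \<in> \<gamma> (i + k)" "?q \<in> \<gamma> (j + k)"
    using filtrationD(2) a b k g by auto
  have dq: "displacement a ?q \<in> \<gamma> n" and dp: "displacement b ?p \<in> \<gamma> n"
    using filtrationD(2)[OF a _ pq(2)] filtrationD(2)[OF b _ pq(1)] k by (simp_all add: n_def ac_simps)
  have z: "commutator G ?q ?p \<in> \<gamma> (Suc n)"
    using k ij by (intro LG.series_commutator_le[OF pq(2,1)]) (auto simp: n_def)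
  then have z': "commutator G ?q ?p \<in> \<gamma> n" "LG.cls n (commutator G ?q ?p) = \<zero>\<^bsub>LG.L\<^esub>"
    using n LG.series_mem_mono[OF z, of n] by (auto simp: LG.cls_eq_zero_iff)
  have h: "?h \<in> \<gamma> k"
    using ab g action_lower_central by simp
  have "b \<otimes>\<^bsub>A\<^esub> a \<in> filtration 1"
    using LA.series_mem_mono[OF a, of 1] LA.series_mem_mono[OF b, of 1] ij LA.series_mult[of 1 b a] by simp
  then have "displacement (b \<otimes>\<^bsub>A\<^esub> a) g \<in> \<gamma> (Suc k)"
    using filtrationD(2)[OF _ k g] by fastforce
  then have "LG.cls k g = LG.cls k ?h"
    using k g h by (simp add: LG.cls_eq_iff)
  then have "action_derivation (i + j) (commutator A a b) (LG.cls k g)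
      = LG.cls n (displacement (commutator A a b) ?h)"
    using action_derivation(2)[OF c(2,1) k h] by (simp add: n_def)
  also have "\<dots> = LG.cls n (inv\<^bsub>G\<^esub> displacement a ?q \<otimes>\<^bsub>G\<^esub> commutator G ?q ?p \<otimes>\<^bsub>G\<^esub> displacement b ?p)"
    by (simp only: displacement_commutator ab)
  also have "\<dots> = \<ominus>\<^bsub>LG.L\<^esub> LG.cls n (displacement a ?q) \<oplus>\<^bsub>LG.L\<^esub> \<zero>\<^bsub>LG.L\<^esub> \<oplus>\<^bsub>LG.L\<^esub> LG.cls n (displacement b ?p)"
    using n dp dq z' by (simp only: LG.cls_mult LG.cls_inv LG.series_mult LG.series_inv)
  also have "\<dots> = LG.cls n (displacement b ?p) \<ominus>\<^bsub>LG.L\<^esub> LG.cls n (displacement a ?q)"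
    using n dp dq LG.cls_closed[of n]
    by (simp only: LG.L.r_zero LG.L.a_inv_closed LG.L.a_comm a_minus_def)
  also have "\<dots> = action_derivation j b (LG.cls (i + k) ?p) \<ominus>\<^bsub>LG.L\<^esub> action_derivation i a (LG.cls (j + k) ?q)"
    using ij a b k pq action_derivation(2)[of j b "i + k" ?p] action_derivation(2)[of i a "j + k" ?q]
    by (simp add: n_def ac_simps)
  also have "\<dots> = (action_derivation i a \<otimes>\<^bsub>der_lie_ring LG.L\<^esub> action_derivation j b) (LG.cls k g)"
    using ij a b k g by (simp only: LG.L.mult_Der LG.cls_closed action_derivation(2))
  finally show "action_derivation (i + j) (commutator A a b) (LG.cls k g)
    = (action_derivation i a \<otimes>\<^bsub>der_lie_ring LG.L\<^esub> action_derivation j b) (LG.cls k g)" .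
qed

text \<open>Existence is the universal property applied to \<open>a \<mapsto> D\<^sub>a\<close>. Uniqueness holds because classes
  generate \<open>L\<^sub>*(A)\<close> and a derivation is determined by its values on the classes in \<open>L\<^sub>*(\<gamma>)\<close>.\<close>

lemma ex1_lie_ring_hom:
  "\<exists>!\<Theta>. \<Theta> \<in> extensional (carrier LA.L) \<and> lie_ring_hom LA.L (der_lie_ring LG.L) \<Theta> \<and>
    (\<forall>i>0. \<forall>x\<in>series_component A filtration i.
        homogeneous_of_degree (series_component G \<gamma>) i (\<Theta> x)) \<and>
    (\<forall>i>0. \<forall>a\<in>filtration i. \<forall>j>0. \<forall>g\<in>\<gamma> j.
        \<Theta> (LA.cls i a) (LG.cls j g) = LG.cls (i + j) (displacement a g))"
proof (rule ex_ex1I)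
  interpret Der: lie_ring "der_lie_ring LG.L"
    by (rule LG.L.lie_ring_Der)
  obtain \<Theta> where ext: "\<Theta> \<in> extensional (carrier LA.L)"
    and hom: "\<Theta> \<in> hom (add_monoid LA.L) (add_monoid (der_lie_ring LG.L))"
    and \<Theta>: "\<And>i a. \<lbrakk>0 < i; a \<in> filtration i\<rbrakk> \<Longrightarrow> \<Theta> (LA.cls i a) = action_derivation i a"
    using LA.additive_extension[OF Der.abelian_group_axioms, of action_derivation]
      action_derivation(1) action_derivation_mult action_derivation_zero
    unfolding LG.L.carrier_Der by blast
  have closed: "\<Theta> u \<in> derivations LG.L" if "u \<in> carrier LA.L" for u
    using hom that by (auto simp: hom_def LG.L.carrier_Der)
  have add: "\<Theta> (u \<oplus>\<^bsub>LA.L\<^esub> v) = \<Theta> u \<oplus>\<^bsub>der_lie_ring LG.L\<^esub> \<Theta> v"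
    if "u \<in> carrier LA.L" "v \<in> carrier LA.L" for u v
    using hom that by (auto simp: hom_def)
  note L_simps = closed add LA.L.lie_closed LA.L.lie_add_left LA.L.lie_add_right
    Der.lie_add_left Der.lie_add_right LG.L.carrier_Der
  have lie_cls: "\<Theta> (LA.cls i a \<otimes>\<^bsub>LA.L\<^esub> v) = \<Theta> (LA.cls i a) \<otimes>\<^bsub>der_lie_ring LG.L\<^esub> \<Theta> v"
    if ia: "0 < i" "a \<in> filtration i" and v: "v \<in> carrier LA.L" for i a v
    using v
  proof (induction v rule: LA.L_induct)
    case (cls j b)
    then show ?case
      using ia LA.series_commutator by (simp add: LA.mult_L_cls \<Theta> action_derivation_commutator)
  next
    case (add v w)
    then show ?case
      using ia by (simp add: L_simps LA.cls_closed)
  qed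
  have lie: "\<Theta> (u \<otimes>\<^bsub>LA.L\<^esub> v) = \<Theta> u \<otimes>\<^bsub>der_lie_ring LG.L\<^esub> \<Theta> v"
    if u: "u \<in> carrier LA.L" and v: "v \<in> carrier LA.L" for u v
    using u
  proof (induction u rule: LA.L_induct)
    case (add u w)
    then show ?case
      using v by (simp add: L_simps)
  qed (rule lie_cls[OF _ _ v])
  have "lie_ring_hom LA.L (der_lie_ring LG.L) \<Theta>"
    using hom lie
    by (intro lie_ring_hom.intro lie_ring_hom_axioms.intro LA.L.lie_ring_axioms Der.lie_ring_axioms) auto
  moreover have "homogeneous_of_degree (series_component G \<gamma>) i (\<Theta> x)"
    if i: "0 < i" and x: "x \<in> series_component A filtration i" for i x
    unfolding homogeneous_of_degree_def
  proof (intro allI impI ballI)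
    fix j :: nat and u assume j: "0 < j" and "u \<in> series_component G \<gamma> j"
    then obtain g where g: "g \<in> \<gamma> j" "u = LG.cls j g"
      by (auto simp: LG.series_component_eq)
    obtain a where a: "a \<in> filtration i" "x = LA.cls i a"
      using i x by (auto simp: LA.series_component_eq)
    have "\<Theta> x u = LG.cls (i + j) (displacement a g)"
      using i j a g by (simp only: \<Theta> action_derivation(2))
    then show "\<Theta> x u \<in> series_component G \<gamma> (i + j)"
      using i j filtrationD(2)[OF a(1) j g(1)] by (simp add: LG.series_component_eq)
  qed
  ultimately show "\<exists>\<Theta>. \<Theta> \<in> extensional (carrier LA.L) \<and> lie_ring_hom LA.L (der_lie_ring LG.L) \<Theta> \<and>
    (\<forall>i>0. \<forall>x\<in>series_component A filtration i.
        homogeneous_of_degree (series_component G \<gamma>) i (\<Theta> x)) \<and>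
    (\<forall>i>0. \<forall>a\<in>filtration i. \<forall>j>0. \<forall>g\<in>\<gamma> j.
        \<Theta> (LA.cls i a) (LG.cls j g) = LG.cls (i + j) (displacement a g))"
    using ext \<Theta> action_derivation(2) by (intro exI[of _ \<Theta>]) simp
next
  fix \<Theta> \<Theta>'
  assume \<Theta>: "\<Theta> \<in> extensional (carrier LA.L) \<and> lie_ring_hom LA.L (der_lie_ring LG.L) \<Theta> \<and>
    (\<forall>i>0. \<forall>x\<in>series_component A filtration i.
        homogeneous_of_degree (series_component G \<gamma>) i (\<Theta> x)) \<and>
    (\<forall>i>0. \<forall>a\<in>filtration i. \<forall>j>0. \<forall>g\<in>\<gamma> j.
        \<Theta> (LA.cls i a) (LG.cls j g) = LG.cls (i + j) (displacement a g))"
    and \<Theta>': "\<Theta>' \<in> extensional (carrier LA.L) \<and> lie_ring_hom LA.L (der_lie_ring LG.L) \<Theta>' \<and>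
    (\<forall>i>0. \<forall>x\<in>series_component A filtration i.
        homogeneous_of_degree (series_component G \<gamma>) i (\<Theta>' x)) \<and>
    (\<forall>i>0. \<forall>a\<in>filtration i. \<forall>j>0. \<forall>g\<in>\<gamma> j.
        \<Theta>' (LA.cls i a) (LG.cls j g) = LG.cls (i + j) (displacement a g))"
  have "lie_ring_hom LA.L (der_lie_ring LG.L) \<Theta>" "lie_ring_hom LA.L (der_lie_ring LG.L) \<Theta>'"
    using \<Theta> \<Theta>' by simp_all
  then have hom: "\<Theta> \<in> hom (add_monoid LA.L) (add_monoid (der_lie_ring LG.L))"
    "\<Theta>' \<in> hom (add_monoid LA.L) (add_monoid (der_lie_ring LG.L))"
    by (simp_all only: lie_ring_hom.hom_add)
  show "\<Theta> = \<Theta>'"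
  proof (rule extensionalityI)
    fix u assume "u \<in> carrier LA.L"
    then show "\<Theta> u = \<Theta>' u"
    proof (induction u rule: LA.L_induct)
      case (cls i a)
      then have "\<Theta> (LA.cls i a) \<in> derivations LG.L" "\<Theta>' (LA.cls i a) \<in> derivations LG.L"
        using hom LA.cls_closed by (auto simp: hom_def LG.L.carrier_Der)
      then show ?case
        using cls \<Theta> \<Theta>' by (intro derivation_eq_classI) auto
    next
      case (add u v)
      then show ?case
        using hom by (simp add: hom_def)
    qed
  qed (use \<Theta> \<Theta>' in auto)
qed

end

section \<open>The induced action and its kernel\<close>

context automorphism_action
begin

abbreviation induced :: "'b \<Rightarrow> (nat \<Rightarrow> 'a set) \<Rightarrow> nat \<Rightarrow> 'a set" where
  "induced \<equiv> induced_action G \<gamma> \<phi>"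

lemma action_image_lower_central:
  assumes "a \<in> carrier A" "0 < n"
  shows "\<phi> a ` \<gamma> n = \<gamma> n"
proof (intro subset_antisym subsetI)
  fix g assume g: "g \<in> \<gamma> n"
  then have "\<phi> (inv\<^bsub>A\<^esub> a) g \<in> \<gamma> n" "g = \<phi> a (\<phi> (inv\<^bsub>A\<^esub> a) g)"
    using assms action_lower_central LG.series_carrier[OF g] by auto
  then show "g \<in> \<phi> a ` \<gamma> n"
    by blast
qed (use assms action_lower_central in blast)

lemma action_image_rcos:
  assumes "a \<in> carrier A" "0 < n" "g \<in> carrier G"
  shows "\<phi> a ` (\<gamma> n #>\<^bsub>G\<^esub> g) = \<gamma> n #>\<^bsub>G\<^esub> \<phi> a g"
proof -
  have "\<phi> a ` (\<gamma> n #>\<^bsub>G\<^esub> g) = (\<lambda>s. \<phi> a s \<otimes>\<^bsub>G\<^esub> \<phi> a g) ` \<gamma> n"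
    using assms LG.series_carrier by (force simp: r_coset_def)
  also have "\<dots> = (\<lambda>s. s \<otimes>\<^bsub>G\<^esub> \<phi> a g) ` (\<phi> a ` \<gamma> n)"
    by (simp add: image_image)
  finally show ?thesis
    unfolding action_image_lower_central[OF assms(1,2)] by (auto simp: r_coset_def)
qed

lemma action_image_one:
  "\<lbrakk>a \<in> carrier A; 0 < k\<rbrakk> \<Longrightarrow> \<phi> a ` \<one>\<^bsub>LG.factor k\<^esub> = \<one>\<^bsub>LG.factor k\<^esub>"
  by (simp add: LG.one_factor action_image_lower_central)

lemma induced_apply:
  "\<lbrakk>u \<in> carrier LG.L; 0 < k\<rbrakk> \<Longrightarrow> induced a u k = \<phi> a ` u k"
  by (simp add: induced_action_def)

lemma induced_closed:
  assumes a: "a \<in> carrier A" and u: "u \<in> carrier LG.L"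
  shows "induced a u \<in> carrier LG.L"
proof -
  have "induced a u k \<in> carrier (LG.factor k)" if k: "0 < k" for k
  proof -
    obtain g where g: "g \<in> \<gamma> k" "u k = \<gamma> (Suc k) #>\<^bsub>G\<^esub> g"
      using LG.L_coord_rep[OF u k] .
    then show ?thesis
      using k a u action_lower_central
      by (simp add: induced_apply action_image_rcos LG.series_carrier LG.carrier_factor)
  qed
  moreover have "{k \<in> {0<..}. induced a u k \<noteq> \<one>\<^bsub>LG.factor k\<^esub>} \<subseteq> {k \<in> {0<..}. u k \<noteq> \<one>\<^bsub>LG.factor k\<^esub>}"
    using a u action_image_one by (auto simp: induced_apply)
  then have "finite {k \<in> {0<..}. induced a u k \<noteq> \<one>\<^bsub>LG.factor k\<^esub>}"
    by (rule finite_subset) (use u in \<open>simp add: LG.carrier_L\<close>)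
  moreover have "induced a u \<in> extensional {0<..}"
    using u by (simp add: induced_action_def)
  ultimately show ?thesis
    by (auto simp: LG.carrier_L PiE_iff)
qed

lemma induced_add:
  assumes a: "a \<in> carrier A" and u: "u \<in> carrier LG.L" and v: "v \<in> carrier LG.L"
  shows "induced a (u \<oplus>\<^bsub>LG.L\<^esub> v) = induced a u \<oplus>\<^bsub>LG.L\<^esub> induced a v"
proof (rule LG.L_eqI)
  fix k :: nat assume k: "0 < k"
  obtain g where g: "g \<in> \<gamma> k" "u k = \<gamma> (Suc k) #>\<^bsub>G\<^esub> g"
    using LG.L_coord_rep[OF u k] .
  obtain h where h: "h \<in> \<gamma> k" "v k = \<gamma> (Suc k) #>\<^bsub>G\<^esub> h"
    using LG.L_coord_rep[OF v k] .
  have "induced a (u \<oplus>\<^bsub>LG.L\<^esub> v) k = \<phi> a ` ((u \<oplus>\<^bsub>LG.L\<^esub> v) k)"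
    using u v k by (intro induced_apply) auto
  also have "\<dots> = (induced a u \<oplus>\<^bsub>LG.L\<^esub> induced a v) k"
    using a u v k g h action_lower_central[OF a]
    by (simp add: induced_apply LG.add_L LG.mult_factor_rcos action_image_rcos LG.series_carrier)
  finally show "induced a (u \<oplus>\<^bsub>LG.L\<^esub> v) k = (induced a u \<oplus>\<^bsub>LG.L\<^esub> induced a v) k" .
qed (use a u v in \<open>auto intro: induced_closed\<close>)

lemma induced_cls:
  assumes a: "a \<in> carrier A" and j: "0 < j" and g: "g \<in> \<gamma> j"
  shows "induced a (LG.cls j g) = LG.cls j (\<phi> a g)"
proof (rule LG.L_eqI)
  show "induced a (LG.cls j g) k = LG.cls j (\<phi> a g) k" if "0 < k" for k
    using that a j g LG.series_carrier[OF g j]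
    by (simp add: induced_apply LG.cls_closed LG.cls_apply action_image_rcos action_image_one)
qed (use a j g in \<open>auto intro: induced_closed action_lower_central\<close>)

lemma induced_mult:
  assumes a: "a \<in> carrier A" and u: "u \<in> carrier LG.L" and v: "v \<in> carrier LG.L"
  shows "induced a (u \<otimes>\<^bsub>LG.L\<^esub> v) = induced a u \<otimes>\<^bsub>LG.L\<^esub> induced a v"
proof -
  note L_simps = induced_closed induced_add LG.L.lie_closed LG.L.lie_add_left LG.L.lie_add_right
  have cls: "induced a (LG.cls j x \<otimes>\<^bsub>LG.L\<^esub> v) = induced a (LG.cls j x) \<otimes>\<^bsub>LG.L\<^esub> induced a v"
    if jx: "0 < j" "x \<in> \<gamma> j" for j x
    using v
  proof (induction v rule: LG.L_induct)
    case (cls k y)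
    have "\<phi> a (commutator G x y) = commutator G (\<phi> a x) (\<phi> a y)"
      using G.hom_commutator[of "\<phi> a" x y] action_group_hom[OF a] jx cls LG.series_carrier
      by (simp add: group_hom.homh)
    then show ?case
      using a jx cls action_lower_central[OF a] LG.series_commutator
      by (simp add: LG.mult_L_cls induced_cls)
  next
    case (add v w)
    then show ?case
      using a jx by (simp add: L_simps LG.cls_closed)
  qed
  show ?thesis
    using u
  proof (induction u rule: LG.L_induct)
    case (add u w)
    then show ?case
      using a v by (simp add: L_simps)
  qed (rule cls)
qed

lemma induced_comp:
  assumes "a \<in> carrier A" "b \<in> carrier A" "u \<in> carrier LG.L"
  shows "induced (a \<otimes>\<^bsub>A\<^esub> b) u = induced b (induced a u)"
proof (rule LG.L_eqI)
  fix k :: nat assume k: "0 < k"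
  obtain g where g: "g \<in> \<gamma> k" "u k = \<gamma> (Suc k) #>\<^bsub>G\<^esub> g"
    using LG.L_coord_rep[OF assms(3) k] .
  then show "induced (a \<otimes>\<^bsub>A\<^esub> b) u k = induced b (induced a u) k"
    using assms k LG.series_carrier[OF g(1) k]
    by (simp add: induced_apply induced_closed action_image_rcos action_comp)
qed (use assms in \<open>auto intro: induced_closed\<close>)

text \<open>The element \<open>a\<close> fixes the class of \<open>g\<close> exactly if its displacement of \<open>g\<close> lies one step deeper, and
  classes generate.\<close>

lemma induced_eq_id_iff:
  assumes a: "a \<in> carrier A"
  shows "(\<forall>u\<in>carrier LG.L. induced a u = u) \<longleftrightarrow> a \<in> filtration 1"
proof -
  have cls: "induced a (LG.cls j g) = LG.cls j g \<longleftrightarrow> displacement a g \<in> \<gamma> (1 + j)"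
    if "0 < j" "g \<in> \<gamma> j" for j g
    using that a action_lower_central LG.cls_eq_iff[of j g "\<phi> a g"] by (auto simp: induced_cls)
  show ?thesis
  proof
    assume "\<forall>u\<in>carrier LG.L. induced a u = u"
    then show "a \<in> filtration 1"
      using a cls by (auto simp: action_series_def)
  next
    assume f: "a \<in> filtration 1"
    show "\<forall>u\<in>carrier LG.L. induced a u = u"
    proof
      fix u assume "u \<in> carrier LG.L"
      then show "induced a u = u"
        by (induction u rule: LG.L_induct) (use a cls filtrationD(2)[OF f] in \<open>auto simp: induced_add\<close>)
    qed
  qed
qed

lemma induced_one: "u \<in> carrier LG.L \<Longrightarrow> induced \<one>\<^bsub>A\<^esub> u = u"
  using induced_eq_id_iff[of "\<one>\<^bsub>A\<^esub>"] LA.series_one[of 1] by simp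

lemma induced_lie_auto:
  assumes a: "a \<in> carrier A"
  shows "induced a \<in> carrier (lie_auto_group LG.L)"
proof -
  have "bij_betw (induced a) (carrier LG.L) (carrier LG.L)"
    by (rule bij_betw_byWitness[of _ "induced (inv\<^bsub>A\<^esub> a)"])
      (use a in \<open>auto simp: induced_closed induced_one simp flip: induced_comp\<close>)
  moreover have "induced a \<in> extensional (carrier LG.L)"
    by (simp add: induced_action_def)
  moreover have "lie_ring_hom LG.L LG.L (induced a)"
    using a by (intro lie_ring_hom.intro lie_ring_hom_axioms.intro LG.L.lie_ring_axioms)
      (auto simp: hom_def induced_closed induced_add induced_mult)
  ultimately show ?thesis
    by (simp add: lie_auto_group_def Bij_def)
qed

abbreviation lie_autos :: "((nat \<Rightarrow> 'a set) \<Rightarrow> nat \<Rightarrow> 'a set) monoid" where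
  "lie_autos \<equiv> opposite_group (lie_auto_group LG.L)"

lemma carrier_lie_autos: "carrier lie_autos = carrier (lie_auto_group LG.L)"
  by (simp add: opposite_group_def)

lemma one_lie_autos: "\<one>\<^bsub>lie_autos\<^esub> = (\<lambda>u\<in>carrier LG.L. u)"
  by (simp add: opposite_group_def lie_auto_group_def BijGroup_def)

lemma mult_lie_autos:
  "\<lbrakk>f \<in> carrier lie_autos; h \<in> carrier lie_autos\<rbrakk>
    \<Longrightarrow> f \<otimes>\<^bsub>lie_autos\<^esub> h = compose (carrier LG.L) h f"
  by (simp add: opposite_group_def lie_auto_group_def BijGroup_def)

lemma induced_mult_lie_autos:
  assumes "a \<in> carrier A" "b \<in> carrier A"
  shows "induced (a \<otimes>\<^bsub>A\<^esub> b) = induced a \<otimes>\<^bsub>lie_autos\<^esub> induced b"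
proof (rule extensionalityI)
  show "induced (a \<otimes>\<^bsub>A\<^esub> b) \<in> extensional (carrier LG.L)"
    by (simp add: induced_action_def)
qed (use assms in \<open>simp_all add: mult_lie_autos carrier_lie_autos induced_lie_auto compose_def induced_comp\<close>)

lemma induced_hom: "induced \<in> hom A lie_autos"
  by (rule homI) (simp_all add: carrier_lie_autos induced_lie_auto induced_mult_lie_autos)

lemma induced_eq_one_iff:
  assumes a: "a \<in> carrier A"
  shows "induced a = \<one>\<^bsub>lie_autos\<^esub> \<longleftrightarrow> a \<in> filtration 1"
proof -
  have "induced a = (\<lambda>u\<in>carrier LG.L. u) \<longleftrightarrow> (\<forall>u\<in>carrier LG.L. induced a u = u)"
  proof
    assume "\<forall>u\<in>carrier LG.L. induced a u = u"
    then show "induced a = (\<lambda>u\<in>carrier LG.L. u)"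
      by (intro extensionalityI[of _ "carrier LG.L"]) (simp_all add: induced_action_def)
  qed simp
  then show ?thesis
    using induced_eq_id_iff[OF a] one_lie_autos by simp
qed

lemma kernel_induced: "kernel A lie_autos induced = filtration 1"
  using induced_eq_one_iff filtrationD(1) by (auto simp: kernel_def)

lemma induced_eq_iff:
  assumes a: "a \<in> carrier A" and b: "b \<in> carrier A"
  shows "induced a = induced b \<longleftrightarrow> filtration 1 #>\<^bsub>A\<^esub> a = filtration 1 #>\<^bsub>A\<^esub> b"
proof -
  interpret N: normal "filtration 1" A
    by (rule filtration_normal) simp
  let ?c = "inv\<^bsub>A\<^esub> a \<otimes>\<^bsub>A\<^esub> b"
  have b_eq: "b = a \<otimes>\<^bsub>A\<^esub> ?c"
    using a b by (simp add: A.word_simps)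
  have "induced a = induced b \<longleftrightarrow> ?c \<in> filtration 1"
  proof
    assume eq: "induced a = induced b"
    have "induced ?c u = u" if "u \<in> carrier LG.L" for u
    proof -
      have "induced ?c u = induced b (induced (inv\<^bsub>A\<^esub> a) u)"
        using a b that by (simp add: induced_comp)
      also have "\<dots> = induced (inv\<^bsub>A\<^esub> a \<otimes>\<^bsub>A\<^esub> a) u"
        using a that eq by (simp only: induced_comp A.inv_closed)
      finally show ?thesis
        using a that by (simp add: induced_one)
    qed
    then show "?c \<in> filtration 1"
      using a b induced_eq_id_iff[of ?c] by simp
  next
    assume c: "?c \<in> filtration 1"
    show "induced a = induced b"
    proof (rule extensionalityI)
      fix u assume u: "u \<in> carrier LG.L"
      have "induced b u = induced ?c (induced a u)"
        using a b u by (subst b_eq) (simp only: induced_comp A.inv_closed A.m_closed)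
      then show "induced a u = induced b u"
        using a b c u induced_eq_id_iff[of ?c] induced_closed by simp
    qed (simp_all add: induced_action_def)
  qed
  then show ?thesis
    unfolding N.rcos_eq_iff[OF a b] .
qed

lemma faithful_representation:
  "\<exists>\<rho>\<in>mon (A Mod filtration 1) lie_autos.
    \<forall>a\<in>carrier A. \<rho> (filtration 1 #>\<^bsub>A\<^esub> a) = induced a"
proof -
  (* The index 1 must keep the form in which the rules about the filtration state it. *)
  note One_nat_def [simp del]
  interpret N: normal "filtration 1" A
    by (rule filtration_normal) simp
  define \<rho> where "\<rho> U = induced (SOME a. a \<in> carrier A \<and> U = filtration 1 #>\<^bsub>A\<^esub> a)" for U
  have \<rho>: "\<rho> (filtration 1 #>\<^bsub>A\<^esub> a) = induced a" if "a \<in> carrier A" for a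
  proof -
    have "\<exists>b. b \<in> carrier A \<and> filtration 1 #>\<^bsub>A\<^esub> a = filtration 1 #>\<^bsub>A\<^esub> b"
      using that by blast
    from someI_ex[OF this] show ?thesis
      using that induced_eq_iff by (simp add: \<rho>_def)
  qed
  have "\<rho> \<in> hom (A Mod filtration 1) lie_autos"
  proof (rule homI)
    fix U V assume "U \<in> carrier (A Mod filtration 1)" "V \<in> carrier (A Mod filtration 1)"
    then obtain a b where "a \<in> carrier A" "b \<in> carrier A"
      "U = filtration 1 #>\<^bsub>A\<^esub> a" "V = filtration 1 #>\<^bsub>A\<^esub> b"
      by (auto simp: carrier_FactGroup)
    then show "\<rho> (U \<otimes>\<^bsub>A Mod filtration 1\<^esub> V) = \<rho> U \<otimes>\<^bsub>lie_autos\<^esub> \<rho> V"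
      by (simp add: N.rcos_sum \<rho> induced_mult_lie_autos)
  qed (auto simp: carrier_FactGroup \<rho> carrier_lie_autos induced_lie_auto)
  moreover have "inj_on \<rho> (carrier (A Mod filtration 1))"
    by (rule inj_onI) (auto simp: carrier_FactGroup \<rho> induced_eq_iff)
  ultimately show ?thesis
    using \<rho> by (auto simp: mon_def)
qed

end

theorem theorem2:
  fixes G :: "('a, 'm) monoid_scheme" and A :: "('b, 'n) monoid_scheme"
    and \<phi> :: "'b \<Rightarrow> 'a \<Rightarrow> 'a"
  assumes "group G" and "group A" and "\<phi> \<in> hom A (opposite_group (AutoGroup G))"
  shows
   "\<comment> \<open>the series \<open>A\<^sub>i\<close>\<close>
    (\<forall>i>0. action_series A G \<phi> i \<lhd> A \<and> action_series A G \<phi> (Suc i) \<subseteq> action_series A G \<phi> i) \<and>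
    (\<forall>i>0. \<forall>j>0. commutator_subgroup A (action_series A G \<phi> i) (action_series A G \<phi> j)
        \<subseteq> action_series A G \<phi> (i + j)) \<and>
    \<comment> \<open>the graded Lie rings \<open>L\<^sub>*(A)\<close> and \<open>L\<^sub>*(\<gamma>)\<close>\<close>
    graded_lie_ring (series_lie_ring A (action_series A G \<phi>))
      (series_component A (action_series A G \<phi>)) \<and>
    (\<forall>i>0. \<forall>j>0. \<forall>a\<in>action_series A G \<phi> i. \<forall>b\<in>action_series A G \<phi> j.
        series_class A (action_series A G \<phi>) i a
          \<otimes>\<^bsub>series_lie_ring A (action_series A G \<phi>)\<^esub> series_class A (action_series A G \<phi>) j b
        = series_class A (action_series A G \<phi>) (i + j) (commutator A a b)) \<and>
    graded_lie_ring (series_lie_ring G (lower_central G)) (series_component G (lower_central G)) \<and>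
    (\<forall>i>0. \<forall>j>0. \<forall>x\<in>lower_central G i. \<forall>y\<in>lower_central G j.
        series_class G (lower_central G) i x
          \<otimes>\<^bsub>series_lie_ring G (lower_central G)\<^esub> series_class G (lower_central G) j y
        = series_class G (lower_central G) (i + j) (commutator G x y)) \<and>
    \<comment> \<open>the derivations \<open>D\<^sub>a\<close>\<close>
    (\<forall>i>0. \<forall>a\<in>action_series A G \<phi> i.
        \<exists>!D. D \<in> derivations (series_lie_ring G (lower_central G)) \<and>
          (\<forall>j>0. \<forall>g\<in>lower_central G j.
             D (series_class G (lower_central G) j g)
             = series_class G (lower_central G) (i + j) (inv\<^bsub>G\<^esub> g \<otimes>\<^bsub>G\<^esub> \<phi> a g))) \<and>
    \<comment> \<open>the graded homomorphism from \<open>L\<^sub>*(A)\<close> to \<open>Der(L\<^sub>*(\<gamma>))\<close>\<close>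
    (\<exists>!\<Theta>. \<Theta> \<in> extensional (carrier (series_lie_ring A (action_series A G \<phi>))) \<and>
        lie_ring_hom (series_lie_ring A (action_series A G \<phi>))
          (der_lie_ring (series_lie_ring G (lower_central G))) \<Theta> \<and>
        (\<forall>i>0. \<forall>x\<in>series_component A (action_series A G \<phi>) i.
            homogeneous_of_degree (series_component G (lower_central G)) i (\<Theta> x)) \<and>
        (\<forall>i>0. \<forall>a\<in>action_series A G \<phi> i. \<forall>j>0. \<forall>g\<in>lower_central G j.
            \<Theta> (series_class A (action_series A G \<phi>) i a) (series_class G (lower_central G) j g)
            = series_class G (lower_central G) (i + j) (inv\<^bsub>G\<^esub> g \<otimes>\<^bsub>G\<^esub> \<phi> a g))) \<and>
    \<comment> \<open>the action of \<open>A\<close> on \<open>L\<^sub>*(\<gamma>)\<close>, with kernel \<open>A\<^sub>1\<close>\<close>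
    induced_action G (lower_central G) \<phi>
      \<in> hom A (opposite_group (lie_auto_group (series_lie_ring G (lower_central G)))) \<and>
    (\<forall>a\<in>carrier A. \<forall>j>0. \<forall>g\<in>lower_central G j.
        induced_action G (lower_central G) \<phi> a (series_class G (lower_central G) j g)
        = series_class G (lower_central G) j (\<phi> a g)) \<and>
    kernel A (opposite_group (lie_auto_group (series_lie_ring G (lower_central G))))
      (induced_action G (lower_central G) \<phi>) = action_series A G \<phi> 1 \<and>
    (\<exists>\<rho>\<in>mon (A Mod action_series A G \<phi> 1)
          (opposite_group (lie_auto_group (series_lie_ring G (lower_central G)))).
        \<forall>a\<in>carrier A. \<rho> (action_series A G \<phi> 1 #>\<^bsub>A\<^esub> a)
          = induced_action G (lower_central G) \<phi> a)"
proof -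
  interpret automorphism_action G A \<phi>
    using assms by (intro automorphism_action.intro automorphism_action_axioms.intro)
  show ?thesis
  proof (intro conjI)
    show "\<forall>i>0. filtration i \<lhd> A \<and> filtration (Suc i) \<subseteq> filtration i"
      using filtration_normal filtration_Suc_subset by blast
    show "\<forall>i>0. \<forall>j>0. commutator_subgroup A (filtration i) (filtration j) \<subseteq> filtration (i + j)"
    proof (intro allI impI)
      fix i j :: nat assume "0 < i" "0 < j"
      then show "commutator_subgroup A (filtration i) (filtration j) \<subseteq> filtration (i + j)"
        by (intro A.commutator_subgroup_subset filtration_subgroup filtration_commutator) auto
    qed
    show "\<forall>i>0. \<forall>j>0. \<forall>a\<in>filtration i. \<forall>b\<in>filtration j.
        LA.cls i a \<otimes>\<^bsub>LA.L\<^esub> LA.cls j b = LA.cls (i + j) (commutator A a b)"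
      using LA.mult_L_cls by simp
    show "\<forall>i>0. \<forall>j>0. \<forall>x\<in>\<gamma> i. \<forall>y\<in>\<gamma> j.
        LG.cls i x \<otimes>\<^bsub>LG.L\<^esub> LG.cls j y = LG.cls (i + j) (commutator G x y)"
      using LG.mult_L_cls by simp
    show "\<forall>i>0. \<forall>a\<in>filtration i. \<exists>!D. D \<in> derivations LG.L \<and>
        (\<forall>j>0. \<forall>g\<in>\<gamma> j. D (LG.cls j g) = LG.cls (i + j) (displacement a g))"
      using ex1_derivation by simp
    show "\<forall>a\<in>carrier A. \<forall>j>0. \<forall>g\<in>\<gamma> j. induced a (LG.cls j g) = LG.cls j (\<phi> a g)"
      using induced_cls by simp
  qed (fact LA.graded_lie_ring_L LG.graded_lie_ring_L ex1_lie_ring_hom induced_hom kernel_induced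
      faithful_representation)+
qed

end
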